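(* Let $d\ge1$, $0<\alpha\le2$, and let $\{Y(\mathbf{u}):\mathbf{u}\in\mathbf{R}^d\}$ be a Gaussian random field with $EY(\mathbf{u})=-\|\mathbf{u}\|^\alpha$ and $\mathrm{Cov}(Y(\mathbf{u}),Y(\mathbf{v}))=\|\mathbf{u}\|^\alpha+\|\mathbf{v}\|^\alpha-\|\mathbf{u}-\mathbf{v}\|^\alpha$. Let $$\widetilde K=\lim_{m\to\infty}m^{-d}\int_0^\infty e^yP\Big\{\sup_{\mathbf{u}\in[0,m]^d}Y(\mathbf{u})\ge y\Big\}\,dy.$$ Then $$\widetilde K=\lim_{\xi\to0}\int_0^\xi E\big[\sigma_d^{-1}(\{\mathbf{u}\in\mathbf{R}^d:-b<Y(\mathbf{u})\le\xi-b\})\big]\,db.$$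
   Context: $\sigma_d$ denotes $d$-dimensional Lebesgue measure and $\sigma_d^{-1}(A)=1/\sigma_d(A)$; $\|\cdot\|$ is the Euclidean norm. $\widetilde K$ is the Pickands-type constant appearing in the asymptotic $P\{\sup_{\mathbf{t}\in D}X(\mathbf{t})\ge c\}\sim(2\pi)^{-1/2}c^{2d/\alpha-1}e^{-c^2/2}a^{d/\alpha}\widetilde K$ (as $c\to\infty$) for an isotropic mean-zero unit-variance Gaussian random field $X$ on $\mathbf{R}^d$ with $E[X(\mathbf{t})X(\mathbf{t}+\mathbf{s})]\sim1-a\|\mathbf{s}\|^\alpha$ as $\|\mathbf{s}\|\to0$, $0<a<\infty$.
   Formalization: The field Y is assumed to have continuous sample paths (its standard continuous version); for an arbitrary version with the same mean and covariance the supremum over [0,m]^d may be non-measurable or changed at a random point, and the identity can fail. *)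

theory Defs
  imports "HOL-Probability.Probability"
begin

definition gaussian_rv :: "'b measure \<Rightarrow> ('b \<Rightarrow> real) \<Rightarrow> real \<Rightarrow> real \<Rightarrow> bool" where
  "gaussian_rv M X mu v \<longleftrightarrow>
     X \<in> borel_measurable M \<and>
     (if v = 0 then (AE \<omega> in M. X \<omega> = mu)
      else v > 0 \<and> distributed M lborel X (normal_density mu (sqrt v)))"

definition gaussian_field ::
  "'b measure \<Rightarrow> ('a \<Rightarrow> 'b \<Rightarrow> real) \<Rightarrow> ('a \<Rightarrow> real) \<Rightarrow> ('a \<Rightarrow> 'a \<Rightarrow> real) \<Rightarrow> bool" where
  "gaussian_field M Y mf C \<longleftrightarrow>
     prob_space M \<and>
     (\<forall>S c. finite S \<longrightarrow>
        gaussian_rv M (\<lambda>\<omega>. \<Sum>u\<in>S. c u * Y u \<omega>)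
          (\<Sum>u\<in>S. c u * mf u) (\<Sum>u\<in>S. \<Sum>v\<in>S. c u * c v * C u v))"

end

theory Submission
  imports Defs "HOL-Complex_Analysis.Cauchy_Integral_Formula" "HOL-Real_Asymp.Real_Asymp"
begin

text \<open>
  Let \<open>W u = Y u + s\<close>, where \<open>s\<close> has the infinite density \<open>e\<^sup>-\<^sup>s ds\<close> independently of \<open>Y\<close>. Tilting by
  \<open>e\<close> to the power \<open>Y v\<close> turns \<open>Y\<close> into a recentred shift of itself, so the law \<open>N\<close> of \<open>W\<close> is shift
  invariant. Put \<open>E = {W > 0}\<close> and \<open>B = {0 < W \<le> \<xi>}\<close>. Up to a factor between \<open>e\<close> to the power \<open>- \<xi>\<close>
  and \<open>1\<close>, the integral in the theorem is the \<open>N\<close>-integral of \<open>1{0 \<in> B} / \<sigma>(B)\<close>; in fact the latter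
  equals \<open>K\<close> for every \<open>\<xi>\<close>. Up to a bounded term, the integral defining \<open>K\<close> is
  \<open>N{W > 0 somewhere on Q}\<close> for the cube \<open>Q\<close> of side \<open>m\<close>.

  Upper bound: by invariance \<open>\<sigma>(Q)\<close> times the integral is \<open>\<integral> \<sigma>(B \<inter> Q) / \<sigma>(B) dN\<close>, and the integrand is at
  most \<open>1\<close> and vanishes unless \<open>W\<close> is positive somewhere on \<open>Q\<close>. Lower bound: by mass transport \<open>B\<close>
  may be replaced by \<open>E\<close>. Writing \<open>1 = \<sigma>(E \<inter> Q) / \<sigma>(E \<inter> Q)\<close> when \<open>W\<close> is positive somewhere on \<open>Q\<close> and cutting
  \<open>Q\<close> into cells of side \<open>r\<close>, every interior cell contributes at most \<open>r\<^sup>d \<integral> 1{0 \<in> E} / \<sigma>(E \<inter> [-r, r]\<^sup>d) dN\<close>,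
  and the boundary cells are negligible because Fernique's argument bounds the contribution of a
  single cell. Letting \<open>r\<close> tend to infinity gives the claim, since \<open>\<sigma>(E) < \<infinity>\<close> almost everywhere.
\<close>

section \<open>Moment generating functions determine laws\<close>

lemma integrable_exp_abs:
  fixes \<mu> :: "real measure"
  assumes [simp, measurable_cong]: "sets \<mu> = sets borel"
    and fin: "\<And>t. (\<integral>\<^sup>+y. ennreal (exp (t * y)) \<partial>\<mu>) < \<infinity>"
  shows "integrable \<mu> (\<lambda>y. exp (t * \<bar>y\<bar>))"
proof -
  have int: "integrable \<mu> (\<lambda>y. exp (t * y))" for t
    using fin[of t] by (intro integrableI_nonneg) auto
  show ?thesis
  proof (rule Bochner_Integration.integrable_bound)
    show "integrable \<mu> (\<lambda>y. exp (t * y) + exp (- t * y))"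
      by (intro Bochner_Integration.integrable_add int)
    show "AE y in \<mu>. norm (exp (t * \<bar>y\<bar>)) \<le> norm (exp (t * y) + exp (- t * y))"
    proof (rule AE_I2)
      fix y
      have "exp (t * \<bar>y\<bar>) \<le> exp (t * y) + exp (- t * y)" by (cases "0 \<le> y") auto
      then show "norm (exp (t * \<bar>y\<bar>)) \<le> norm (exp (t * y) + exp (- t * y))" by simp
    qed
  qed simp
qed

text \<open>Expand \<open>exp (z * y)\<close> and integrate term by term; every partial sum is
  dominated by \<open>exp (norm z * \<bar>y\<bar>)\<close>. The point is that the transform is
  entire in \<open>z\<close>.\<close>

lemma mgf_power_series:
  fixes \<mu> :: "real measure"
  assumes [simp, measurable_cong]: "sets \<mu> = sets borel"
    and fin: "\<And>t. (\<integral>\<^sup>+y. ennreal (exp (t * y)) \<partial>\<mu>) < \<infinity>"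
  shows "(\<lambda>n. complex_of_real (\<integral>y. y ^ n / fact n \<partial>\<mu>) * z ^ n) sums (\<integral>y. exp (z * complex_of_real y) \<partial>\<mu>)"
proof -
  have bound: "\<bar>x ^ n / fact n\<bar> \<le> exp \<bar>x\<bar>" for n and x :: real
  proof -
    have "(\<lambda>n. \<bar>x\<bar> ^ n /\<^sub>R fact n) sums exp \<bar>x\<bar>" by (rule exp_converges)
    then have "(\<Sum>k\<in>{n}. \<bar>x\<bar> ^ k /\<^sub>R fact k) \<le> exp \<bar>x\<bar>"
      by (intro sum_le_suminf[THEN order_trans]) (auto simp: sums_iff)
    then show ?thesis by (simp add: power_abs divide_inverse abs_mult mult.commute)
  qed
  have int: "integrable \<mu> (\<lambda>y. y ^ n / fact n)" for n
    by (rule Bochner_Integration.integrable_bound[OF integrable_exp_abs[of \<mu> 1]])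
      (use bound fin in auto)
  have intc: "integrable \<mu> (\<lambda>y. (z * complex_of_real y) ^ n /\<^sub>R fact n)" for n
  proof -
    have "integrable \<mu> (\<lambda>y. z ^ n * complex_of_real (y ^ n / fact n))"
      by (intro integrable_mult_right integrable_of_real int)
    also have "(\<lambda>y. z ^ n * complex_of_real (y ^ n / fact n)) = (\<lambda>y. (z * complex_of_real y) ^ n /\<^sub>R fact n)"
      by (auto simp: power_mult_distrib scaleR_conv_of_real divide_inverse)
    finally show ?thesis .
  qed
  have eq: "(\<integral>y. (z * complex_of_real y) ^ n /\<^sub>R fact n \<partial>\<mu>) = complex_of_real (\<integral>y. y ^ n / fact n \<partial>\<mu>) * z ^ n" for n
  proof -
    have "(\<integral>y. (z * complex_of_real y) ^ n /\<^sub>R fact n \<partial>\<mu>) = (\<integral>y. z ^ n * complex_of_real (y ^ n / fact n) \<partial>\<mu>)"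
      by (intro Bochner_Integration.integral_cong) (auto simp: power_mult_distrib scaleR_conv_of_real divide_inverse)
    then show ?thesis by (simp only: integral_mult_right_zero integral_complex_of_real mult.commute)
  qed
  have "(\<lambda>n. \<integral>y. (\<Sum>k<n. (z * complex_of_real y) ^ k /\<^sub>R fact k) \<partial>\<mu>) \<longlonglongrightarrow> (\<integral>y. exp (z * complex_of_real y) \<partial>\<mu>)"
  proof (rule integral_dominated_convergence[where w="\<lambda>y. exp (norm z * \<bar>y\<bar>)"])
    show "integrable \<mu> (\<lambda>y. exp (norm z * \<bar>y\<bar>))"
      by (rule integrable_exp_abs) (use fin in auto)
    show "AE y in \<mu>. (\<lambda>n. \<Sum>k<n. (z * complex_of_real y) ^ k /\<^sub>R fact k) \<longlonglongrightarrow> exp (z * complex_of_real y)"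
      using exp_converges[of "z * complex_of_real y" for y] by (simp add: sums_def)
    show "AE y in \<mu>. norm (\<Sum>k<n. (z * complex_of_real y) ^ k /\<^sub>R fact k) \<le> exp (norm z * \<bar>y\<bar>)" for n
    proof (rule AE_I2)
      fix y :: real
      have "norm (\<Sum>k<n. (z * complex_of_real y) ^ k /\<^sub>R fact k) \<le> (\<Sum>k<n. (norm z * \<bar>y\<bar>) ^ k /\<^sub>R fact k)"
        by (rule sum_norm_le) (simp add: norm_power norm_mult)
      also have "\<dots> \<le> (\<Sum>k. (norm z * \<bar>y\<bar>) ^ k /\<^sub>R fact k)"
        using exp_converges[of "norm z * \<bar>y\<bar>"] by (intro sum_le_suminf) (auto simp: sums_iff)
      also have "\<dots> = exp (norm z * \<bar>y\<bar>)"
        using exp_converges[of "norm z * \<bar>y\<bar>"] by (simp add: sums_iff)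
      finally show "norm (\<Sum>k<n. (z * complex_of_real y) ^ k /\<^sub>R fact k) \<le> exp (norm z * \<bar>y\<bar>)" .
    qed
  qed auto
  then show ?thesis
    unfolding sums_def by (simp only: Bochner_Integration.integral_sum[OF intc] eq)
qed

text \<open>Both transforms are entire and they agree on the real axis, hence everywhere; at
  imaginary points they are the characteristic functions.\<close>

lemma char_eq_if_mgf_eq:
  fixes \<mu> \<nu> :: "real measure"
  assumes s[simp, measurable_cong]: "sets \<mu> = sets borel" "sets \<nu> = sets borel"
    and fin: "\<And>t. (\<integral>\<^sup>+y. ennreal (exp (t * y)) \<partial>\<mu>) < \<infinity>"
    and eq: "\<And>t. (\<integral>\<^sup>+y. ennreal (exp (t * y)) \<partial>\<mu>) = (\<integral>\<^sup>+y. ennreal (exp (t * y)) \<partial>\<nu>)"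
  shows "char \<mu> = char \<nu>"
proof -
  define a where "a n = complex_of_real (\<integral>y. y ^ n / fact n \<partial>\<mu>) - complex_of_real (\<integral>y. y ^ n / fact n \<partial>\<nu>)" for n
  define F where "F z = (\<integral>y. exp (z * complex_of_real y) \<partial>\<mu>) - (\<integral>y. exp (z * complex_of_real y) \<partial>\<nu>)" for z
  have fin': "(\<integral>\<^sup>+y. ennreal (exp (t * y)) \<partial>\<nu>) < \<infinity>" for t using fin[of t] eq[of t] by simp
  have sums: "(\<lambda>n. a n * z ^ n) sums F z" for z
    unfolding a_def F_def left_diff_distrib
    by (intro sums_diff mgf_power_series s fin fin')
  have F0: "F (complex_of_real t) = 0" for t
  proof -
    have "(\<integral>y. exp (t * y) \<partial>\<mu>) = (\<integral>y. exp (t * y) \<partial>\<nu>)"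
      by (simp add: integral_eq_nn_integral eq)
    then have "(\<integral>y. complex_of_real (exp (t * y)) \<partial>\<mu>) = (\<integral>y. complex_of_real (exp (t * y)) \<partial>\<nu>)"
      by simp
    then show ?thesis by (simp add: F_def exp_of_real flip: of_real_mult)
  qed
  have "a m = 0" for m
  proof (rule ccontr)
    assume m: "a m \<noteq> 0"
    have "a 0 = 0" using sums[of 0] F0[of 0] by simp
    with m have "0 < m" by (cases m) auto
    \<comment> \<open>A power series with a nonzero coefficient has isolated zeros, but
      \<open>F\<close> vanishes at all real points near 0.\<close>
    obtain s where s: "0 < s" "\<And>z. z \<in> cball 0 s - {0} \<Longrightarrow> F z \<noteq> 0"
      by (rule powser_0_nonzero[of 1 0 a F m]) (use sums F0[of 0] m \<open>0 < m\<close> in auto)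
    have "complex_of_real s \<in> cball 0 s - {0}" using s(1) by simp
    with s(2) F0[of s] show False by blast
  qed
  then have "F z = 0" for z using sums[of z] sums_unique2[OF _ sums_zero] by auto
  from this[of "\<i> * complex_of_real t" for t] show ?thesis
    by (auto simp: char_def F_def fun_eq_iff mult.assoc)
qed

text \<open>The total masses agree at \<open>t = 0\<close>, so both measures can be normalised and
  Levy uniqueness applies. Any finite mass is allowed because the next lemma applies this to
  weighted laws.\<close>

lemma measure_eqI_mgf:
  fixes \<mu> \<nu> :: "real measure"
  assumes s[simp, measurable_cong]: "sets \<mu> = sets borel" "sets \<nu> = sets borel"
    and fin: "\<And>t. (\<integral>\<^sup>+y. ennreal (exp (t * y)) \<partial>\<mu>) < \<infinity>"
    and eq: "\<And>t. (\<integral>\<^sup>+y. ennreal (exp (t * y)) \<partial>\<mu>) = (\<integral>\<^sup>+y. ennreal (exp (t * y)) \<partial>\<nu>)"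
  shows "\<mu> = \<nu>"
proof -
  have sp[simp]: "space \<mu> = UNIV" "space \<nu> = UNIV" using s[THEN sets_eq_imp_space_eq] by auto
  define c where "c = emeasure \<mu> UNIV"
  have c: "emeasure \<nu> UNIV = c" "c < \<infinity>" using eq[of 0] fin[of 0] by (simp_all add: c_def)
  show ?thesis
  proof (cases "c = 0")
    case True
    have "emeasure \<mu> A = emeasure \<nu> A" for A
      using emeasure_space[of \<mu> A] emeasure_space[of \<nu> A] c True by (simp add: c_def)
    then show ?thesis by (intro measure_eqI) auto
  next
    case False
    define k where "k = inverse c"
    have k: "k * c = 1" "k < \<infinity>" "k \<noteq> 0"
      using False c by (auto simp: k_def ennreal_inverse_positive mult.commute ennreal_divide_self[of c] divide_ennreal_def[symmetric] less_top[symmetric] ennreal_inverse_eq_top_iff)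
    have pr: "real_distribution (scale_measure k \<mu>)" "real_distribution (scale_measure k \<nu>)"
      using k c by (auto intro!: prob_spaceI simp: real_distribution_def real_distribution_axioms_def space_scale_measure c_def)
    have "scale_measure k \<mu> = scale_measure k \<nu>"
    proof (rule Levy_uniqueness[OF pr char_eq_if_mgf_eq])
      show "(\<integral>\<^sup>+y. ennreal (exp (t * y)) \<partial>scale_measure k \<mu>) < \<infinity>" for t
        using fin[of t] k by (simp add: nn_integral_scale_measure ennreal_mult_less_top)
    qed (simp_all add: nn_integral_scale_measure eq)
    then have "c * emeasure (scale_measure k \<mu>) A = c * emeasure (scale_measure k \<nu>) A" for A by simp
    then have "emeasure \<mu> A = emeasure \<nu> A" for A
      using k by (simp add: mult.assoc[symmetric] mult.commute[of c])
    then show ?thesis by (intro measure_eqI) auto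
  qed
qed

text \<open>Uniqueness in infinitely many variables is reduced to one dimension: exponential factors
  are traded for indicators one coordinate at a time, and the resulting masses of cylinders
  determine the law.\<close>

lemma distr_PiM_eqI_mgf:
  fixes X :: "'i \<Rightarrow> 'b \<Rightarrow> real" and X' :: "'i \<Rightarrow> 'c \<Rightarrow> real"
  assumes [measurable]: "\<And>i. X i \<in> borel_measurable M" "\<And>i. X' i \<in> borel_measurable M'"
    and fin: "\<And>S c. finite S \<Longrightarrow> (\<integral>\<^sup>+x. ennreal (exp (\<Sum>i\<in>S. c i * X i x)) \<partial>M) < \<infinity>"
    and eq: "\<And>S c. finite S \<Longrightarrow> (\<integral>\<^sup>+x. ennreal (exp (\<Sum>i\<in>S. c i * X i x)) \<partial>M)
                = (\<integral>\<^sup>+x. ennreal (exp (\<Sum>i\<in>S. c i * X' i x)) \<partial>M')"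
  shows "distr M (PiM UNIV (\<lambda>_. borel)) (\<lambda>x i. X i x) = distr M' (PiM UNIV (\<lambda>_. borel)) (\<lambda>x i. X' i x)"
proof -
  have [measurable]: "(\<lambda>x i. X i x) \<in> M \<rightarrow>\<^sub>M PiM UNIV (\<lambda>_. borel)" "(\<lambda>x i. X' i x) \<in> M' \<rightarrow>\<^sub>M PiM UNIV (\<lambda>_. borel)"
    by (auto intro!: measurable_PiM_single')
  have main: "(\<integral>\<^sup>+x. (\<Prod>i\<in>J. indicator (A i) (X i x)) * ennreal (exp (\<Sum>i\<in>S. c i * X i x)) \<partial>M)
           = (\<integral>\<^sup>+x. (\<Prod>i\<in>J. indicator (A i) (X' i x)) * ennreal (exp (\<Sum>i\<in>S. c i * X' i x)) \<partial>M')"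
    if "finite J" "finite S" "\<And>i. i \<in> J \<Longrightarrow> A i \<in> sets borel" for J S c and A :: "'i \<Rightarrow> real set"
    using that
  proof (induction J arbitrary: S c rule: finite_induct)
    case empty
    then show ?case using eq by simp
  next
    case (insert j J)
    note [measurable] = insert.prems(2)
    define w where "w x = (\<Prod>i\<in>J. indicator (A i) (X i x)) * ennreal (exp (\<Sum>i\<in>S. c i * X i x))" for x
    define w' where "w' x = (\<Prod>i\<in>J. indicator (A i) (X' i x)) * ennreal (exp (\<Sum>i\<in>S. c i * X' i x))" for x
    have [measurable]: "w \<in> borel_measurable M" "w' \<in> borel_measurable M'"
      unfolding w_def w'_def by (measurable; simp)+
    define \<mu> where "\<mu> = distr (density M w) borel (X j)"
    define \<nu> where "\<nu> = distr (density M' w') borel (X' j)"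
    \<comment> \<open>The coefficients after absorbing \<open>t * X j\<close> into the exponential
      sum, whether or not \<open>j\<close> already lies in \<open>S\<close>.\<close>
    define cc where "cc t i = (if i \<in> S then c i else 0) + (if i = j then t else 0)" for t i
    have cc: "(\<Sum>i\<in>S. c i * f i) + t * f j = (\<Sum>i\<in>insert j S. cc t i * f i)" for f :: "'i \<Rightarrow> real" and t
    proof -
      have "(\<Sum>i\<in>insert j S. cc t i * f i) = (\<Sum>i\<in>insert j S. (if i \<in> S then c i else 0) * f i) + (\<Sum>i\<in>insert j S. (if i = j then t else 0) * f i)"
        by (simp add: cc_def distrib_right sum.distrib)
      also have "(\<Sum>i\<in>insert j S. (if i \<in> S then c i else 0) * f i) = (\<Sum>i\<in>S. c i * f i)"
        using insert.prems(1) by (intro sum.mono_neutral_cong_right) auto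
      also have "(\<Sum>i\<in>insert j S. (if i = j then t else 0) * f i) = (\<Sum>i\<in>{j}. t * f i)"
        using insert.prems(1) by (intro sum.mono_neutral_cong_right) auto
      finally show ?thesis by simp
    qed
    have *: "w x * ennreal (exp (t * X j x)) = (\<Prod>i\<in>J. indicator (A i) (X i x)) * ennreal (exp (\<Sum>i\<in>insert j S. cc t i * X i x))"
      "w' y * ennreal (exp (t * X' j y)) = (\<Prod>i\<in>J. indicator (A i) (X' i y)) * ennreal (exp (\<Sum>i\<in>insert j S. cc t i * X' i y))" for t x y
      unfolding w_def w'_def cc[symmetric] exp_add by (simp_all add: ennreal_mult mult.assoc)
    have "\<mu> = \<nu>"
    proof (rule measure_eqI_mgf)
      fix t
      have le1: "(\<Prod>i\<in>J. indicator (A i) (X i x)) \<le> (1::ennreal)" for x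
        by (intro prod_le_1) (auto split: split_indicator)
      have L: "(\<integral>\<^sup>+y. ennreal (exp (t * y)) \<partial>\<mu>) = (\<integral>\<^sup>+x. w x * ennreal (exp (t * X j x)) \<partial>M)"
        unfolding \<mu>_def by (subst nn_integral_distr) (auto simp: nn_integral_density)
      have R: "(\<integral>\<^sup>+y. ennreal (exp (t * y)) \<partial>\<nu>) = (\<integral>\<^sup>+x. w' x * ennreal (exp (t * X' j x)) \<partial>M')"
        unfolding \<nu>_def by (subst nn_integral_distr) (auto simp: nn_integral_density)
      show "(\<integral>\<^sup>+y. ennreal (exp (t * y)) \<partial>\<mu>) = (\<integral>\<^sup>+y. ennreal (exp (t * y)) \<partial>\<nu>)"
        unfolding L R * by (rule insert.IH) (use insert.prems in auto)
      have "(\<integral>\<^sup>+x. w x * ennreal (exp (t * X j x)) \<partial>M) \<le> (\<integral>\<^sup>+x. 1 * ennreal (exp (\<Sum>i\<in>insert j S. cc t i * X i x)) \<partial>M)"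
        unfolding * by (intro nn_integral_mono mult_right_mono le1) auto
      also have "\<dots> < \<infinity>" using fin[of "insert j S" "cc t"] insert.prems by simp
      finally show "(\<integral>\<^sup>+y. ennreal (exp (t * y)) \<partial>\<mu>) < \<infinity>" unfolding L .
    qed (simp_all add: \<mu>_def \<nu>_def)
    \<comment> \<open>Equality of the weighted laws of coordinate \<open>j\<close> permits testing
      with an indicator instead of an exponential.\<close>
    then have "(\<integral>\<^sup>+y. indicator (A j) y \<partial>\<mu>) = (\<integral>\<^sup>+y. indicator (A j) y \<partial>\<nu>)" by simp
    then have "(\<integral>\<^sup>+x. w x * indicator (A j) (X j x) \<partial>M) = (\<integral>\<^sup>+x. w' x * indicator (A j) (X' j x) \<partial>M')"
      unfolding \<mu>_def \<nu>_def using insert.prems(2)[of j]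
      by (simp add: nn_integral_distr nn_integral_density del: nn_integral_indicator)
    then show ?case
      using insert.hyps by (simp add: w_def w'_def mult_ac)
  qed
  show ?thesis
  proof (rule measure_eqI_PiM_infinite)
    fix A :: "'i \<Rightarrow> real set" and J :: "'i set"
    assume J: "finite J" and A: "\<And>i. i \<in> J \<Longrightarrow> A i \<in> sets borel"
    have set: "prod_emb UNIV (\<lambda>_. borel) J (Pi\<^sub>E J A) = {f. \<forall>i\<in>J. f i \<in> A i}"
      by (auto simp: prod_emb_def PiE_iff space_PiM)
    have m: "prod_emb UNIV (\<lambda>_. borel) J (Pi\<^sub>E J A) \<in> sets (PiM UNIV (\<lambda>_. borel))"
      using J A by (intro sets_PiM_I) auto
    have ind: "indicator {f. \<forall>i\<in>J. f i \<in> A i} g = (\<Prod>i\<in>J. indicator (A i) (g i) :: ennreal)" for g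
      using J by (auto split: split_indicator simp: prod_zero_iff)
    have "emeasure (distr M (PiM UNIV (\<lambda>_. borel)) (\<lambda>x i. X i x)) (prod_emb UNIV (\<lambda>_. borel) J (Pi\<^sub>E J A))
      = (\<integral>\<^sup>+x. (\<Prod>i\<in>J. indicator (A i) (X i x)) * ennreal (exp (\<Sum>i\<in>{}. 0 * X i x)) \<partial>M)"
      using m by (subst nn_integral_indicator[symmetric]) (auto simp: nn_integral_distr set ind simp del: nn_integral_indicator)
    also have "\<dots> = (\<integral>\<^sup>+x. (\<Prod>i\<in>J. indicator (A i) (X' i x)) * ennreal (exp (\<Sum>i\<in>{}. 0 * X' i x)) \<partial>M')"
      by (rule main[where S="{}" and c="\<lambda>_. 0"]) (use J A in auto)
    also have "\<dots> = emeasure (distr M' (PiM UNIV (\<lambda>_. borel)) (\<lambda>x i. X' i x)) (prod_emb UNIV (\<lambda>_. borel) J (Pi\<^sub>E J A))"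
      using m by (subst nn_integral_indicator[symmetric]) (auto simp: nn_integral_distr set ind simp del: nn_integral_indicator)
    finally show "emeasure (distr M (PiM UNIV (\<lambda>_. borel)) (\<lambda>x i. X i x)) (prod_emb UNIV (\<lambda>_. borel) J (Pi\<^sub>E J A))
      = emeasure (distr M' (PiM UNIV (\<lambda>_. borel)) (\<lambda>x i. X' i x)) (prod_emb UNIV (\<lambda>_. borel) J (Pi\<^sub>E J A))" .
  next
    show "finite_measure (distr M (PiM UNIV (\<lambda>_. borel)) (\<lambda>x i. X i x))"
    proof (rule finite_measureI)
      have "emeasure (distr M (PiM UNIV (\<lambda>_. borel)) (\<lambda>x i. X i x)) (space (distr M (PiM UNIV (\<lambda>_. borel)) (\<lambda>x i. X i x))) = emeasure M (space M)"
        by (subst space_distr, subst emeasure_distr[OF _ sets.top]) (auto simp: space_PiM intro!: arg_cong[where f="emeasure M"])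
      also have "\<dots> < \<infinity>" using fin[of "{}" undefined] by simp
      finally show "emeasure (distr M (PiM UNIV (\<lambda>_. borel)) (\<lambda>x i. X i x)) (space (distr M (PiM UNIV (\<lambda>_. borel)) (\<lambda>x i. X i x))) \<noteq> \<infinity>" by simp
    qed
  qed simp_all
qed

section \<open>Measurability along continuous paths\<close>

text \<open>A fixed choice of finitely valued Borel maps tending pointwise to the identity. The
  finite range makes evaluating a path at the approximate point measurable.\<close>

definition simple_approx :: "nat \<Rightarrow> 'a::euclidean_space \<Rightarrow> 'a" where
  "simple_approx = (SOME F. (\<forall>n. simple_function borel (F n)) \<and> (\<forall>u. (\<lambda>n. F n u) \<longlonglongrightarrow> u))"

lemma simple_approx:
  "simple_function borel (simple_approx n :: 'a::euclidean_space \<Rightarrow> 'a)"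
  "(\<lambda>n. simple_approx n (u::'a)) \<longlonglongrightarrow> u"
proof -
  have "\<exists>F::nat \<Rightarrow> 'a \<Rightarrow> 'a. (\<forall>n. simple_function borel (F n)) \<and> (\<forall>u. (\<lambda>n. F n u) \<longlonglongrightarrow> u)"
    using borel_measurable_implies_sequence_metric[of "\<lambda>u::'a. u" borel 0] by auto
  from someI_ex[OF this]
  show "simple_function borel (simple_approx n :: 'a \<Rightarrow> 'a)" "(\<lambda>n. simple_approx n u) \<longlonglongrightarrow> u"
    by (auto simp: simple_approx_def)
qed

text \<open>Equal to \<^term>\<open>f\<close> when \<^term>\<open>f\<close> is continuous, and, unlike \<^term>\<open>f u\<close>, jointly measurable
  in \<^term>\<open>f\<close> and \<^term>\<open>u\<close> on the whole product space.\<close>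

definition regularize :: "('a::euclidean_space \<Rightarrow> real) \<Rightarrow> 'a \<Rightarrow> real" where
  "regularize f u = lim (\<lambda>n. f (simple_approx n u))"

lemma regularize_continuous: "continuous_on UNIV f \<Longrightarrow> regularize f = f"
  unfolding regularize_def
  by (intro ext limI) (metis UNIV_I continuous_on_tendsto_compose eventually_sequentiallyI simple_approx(2))

text \<open>For each \<open>n\<close> only finitely many coordinates of \<open>f\<close> are
  consulted, selected measurably by \<open>u\<close>; measurability survives the limit.\<close>

lemma measurable_regularize_pair [measurable]:
  "(\<lambda>(f, u::'a::euclidean_space). regularize f u) \<in> PiM UNIV (\<lambda>_. borel) \<Otimes>\<^sub>M borel \<rightarrow>\<^sub>M (borel :: real measure)"
proof -
  have [measurable]: "(\<lambda>p. fst p (simple_approx n (snd p))) \<in> PiM UNIV (\<lambda>_::'a. borel) \<Otimes>\<^sub>M borel \<rightarrow>\<^sub>M (borel :: real measure)" for n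
  proof (rule measurable_compose_countable'[where I="range (simple_approx n :: 'a \<Rightarrow> 'a)"])
    have fin: "finite (range (simple_approx n :: 'a \<Rightarrow> 'a))"
      using simple_approx(1)[where 'a='a, of n] by (simp add: simple_function_def)
    then show "countable (range (simple_approx n :: 'a \<Rightarrow> 'a))" by (rule countable_finite)
    have "simple_approx n \<in> borel \<rightarrow>\<^sub>M count_space (range (simple_approx n :: 'a \<Rightarrow> 'a))"
      using simple_approx(1)[where 'a='a, of n] fin by (auto simp: measurable_count_space_eq2 simple_function_def)
    then show "(\<lambda>p. simple_approx n (snd p)) \<in> PiM UNIV (\<lambda>_. borel) \<Otimes>\<^sub>M borel \<rightarrow>\<^sub>M count_space (range (simple_approx n :: 'a \<Rightarrow> 'a))"
      by measurable
  qed measurable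
  show ?thesis
    unfolding regularize_def split_beta by measurable
qed

lemma measurable_regularize_at [measurable]: "(\<lambda>f. regularize f u) \<in> borel_measurable (PiM UNIV (\<lambda>_. borel))"
proof -
  have "(\<lambda>f. (f, u)) \<in> PiM UNIV (\<lambda>_. borel) \<rightarrow>\<^sub>M PiM UNIV (\<lambda>_. borel) \<Otimes>\<^sub>M borel" by simp
  from measurable_compose[OF this measurable_regularize_pair] show ?thesis by simp
qed

lemma measurable_occupation_regularize [measurable]:
  assumes [measurable]: "A \<in> sets borel" "J \<in> sets borel"
  shows "(\<lambda>f. emeasure lborel {u\<in>A. regularize f u \<in> J}) \<in> borel_measurable (PiM UNIV (\<lambda>_. borel))"
proof -
  have "{p \<in> space (PiM UNIV (\<lambda>_. borel) \<Otimes>\<^sub>M lborel). snd p \<in> A \<and> (case p of (f, u) \<Rightarrow> regularize f u) \<in> J}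
      \<in> sets (PiM UNIV (\<lambda>_. borel) \<Otimes>\<^sub>M lborel)"
    by measurable
  from lborel.measurable_emeasure_Pair[OF this] show ?thesis
    by (auto simp: space_pair_measure space_PiM vimage_def)
qed

section \<open>Lebesgue measure under translation and reflection, and inverses in
  \<open>ennreal\<close>\<close>

lemma emeasure_lborel_translate:
  fixes v :: "'a::euclidean_space"
  assumes [measurable]: "A \<in> sets borel"
  shows "emeasure lborel {u. u + v \<in> A} = emeasure lborel A"
proof -
  have "emeasure lborel A = emeasure (distr lborel borel ((+) v)) A" by (simp add: lborel_distr_plus)
  also have "\<dots> = emeasure lborel {u. u + v \<in> A}"
    by (subst emeasure_distr) (auto simp: vimage_def add.commute)
  finally show ?thesis ..
qed

lemma nn_integral_lborel_reflect:
  fixes f :: "'a::euclidean_space \<Rightarrow> ennreal"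
  assumes [measurable]: "f \<in> borel_measurable borel"
  shows "(\<integral>\<^sup>+u. f (- u) \<partial>lborel) = (\<integral>\<^sup>+u. f u \<partial>lborel)"
  by (subst (2) lborel_affine[of "-1" 0]) (simp_all add: nn_integral_density nn_integral_distr)

lemma emeasure_lborel_open_pos:
  fixes S :: "'a::euclidean_space set"
  assumes "open S" "S \<noteq> {}"
  shows "0 < emeasure lborel S"
proof -
  have "\<not> negligible S" by (rule open_not_negligible) fact+
  moreover have "S \<in> sets borel" using assms by simp
  ultimately have "emeasure lborel S \<noteq> 0"
    by (auto simp: negligible_iff_null_sets null_sets_def)
  then show ?thesis by (simp add: zero_less_iff_neq_zero)
qed

lemma ennreal_mult_inverse_self: "(a::ennreal) \<noteq> 0 \<Longrightarrow> a < \<infinity> \<Longrightarrow> a * inverse a = 1"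
  by (simp add: ennreal_divide_self divide_ennreal_def[symmetric])

text \<open>In the degenerate cases the product is 0: \<open>b = 0\<close> forces
  \<open>a = 0\<close>, with \<open>0 * \<infinity> = 0\<close>, and
  \<open>inverse \<infinity> = 0\<close>.\<close>

lemma ennreal_mult_inverse_le_1: "(a::ennreal) \<le> b \<Longrightarrow> a * inverse b \<le> 1"
proof (cases "b = 0 \<or> b = \<infinity>")
  case False
  assume "a \<le> b"
  then have "a * inverse b \<le> b * inverse b" by (rule mult_right_mono) simp
  also have "\<dots> = 1" using False by (intro ennreal_mult_inverse_self) (auto simp: less_top)
  finally show ?thesis .
qed auto

lemma ennreal_inverse_antimono: "(a::ennreal) \<le> b \<Longrightarrow> inverse b \<le> inverse a"
proof (cases "a = 0 \<or> a = \<infinity>")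
  case False
  assume "a \<le> b"
  then have "a * inverse b * inverse a \<le> 1 * inverse a"
    by (intro mult_right_mono ennreal_mult_inverse_le_1) auto
  also have "a * inverse b * inverse a = (a * inverse a) * inverse b" by (simp add: mult_ac)
  also have "a * inverse a = 1" using False by (intro ennreal_mult_inverse_self) (auto simp: less_top)
  finally show ?thesis by simp
qed (auto simp: top_unique)

lemma emeasure_cube: "0 \<le> r \<Longrightarrow> emeasure lborel (cbox (a::'a::euclidean_space) (a + r *\<^sub>R One)) = ennreal (r ^ DIM('a))"
  by (subst emeasure_lborel_cbox) (auto simp: inner_simps)

section \<open>Shift-invariant fields\<close>

text \<open>The measure \<open>N\<close> may be infinite; shift invariance is phrased through
  integrals of nonnegative functionals that are measurable for the product sigma-algebra.\<close>

locale stationary_field = sigma_finite_measure N for N :: "'c measure" +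
  fixes W :: "'a::euclidean_space \<Rightarrow> 'c \<Rightarrow> real"
  assumes W_measurable [measurable]: "\<And>u. W u \<in> borel_measurable N"
    and W_continuous: "\<And>x. x \<in> space N \<Longrightarrow> continuous_on UNIV (\<lambda>u. W u x)"
    and W_stationary: "\<And>v F. F \<in> borel_measurable (PiM UNIV (\<lambda>_. borel)) \<Longrightarrow>
      (\<integral>\<^sup>+x. F (\<lambda>u. W (u + v) x) \<partial>N) = (\<integral>\<^sup>+x. F (\<lambda>u. W u x) \<partial>N)"
begin

section \<open>Joint measurability and admissible path functionals\<close>

sublocale pair_sigma_finite N "lborel :: 'a measure" ..

lemma W_pair_measurable [measurable]: "(\<lambda>(x, u). W u x) \<in> N \<Otimes>\<^sub>M borel \<rightarrow>\<^sub>M borel"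
proof -
  have [measurable]: "(\<lambda>x u. W u x) \<in> N \<rightarrow>\<^sub>M PiM UNIV (\<lambda>_. borel)"
    by (auto intro!: measurable_PiM_single')
  have "(\<lambda>(x, u). regularize (\<lambda>u. W u x) u) \<in> N \<Otimes>\<^sub>M borel \<rightarrow>\<^sub>M borel" by measurable
  then show ?thesis
    by (rule measurable_cong[THEN iffD1, rotated])
      (auto simp: space_pair_measure regularize_continuous[OF W_continuous])
qed

text \<open>Occupation volumes need not be measurable on the whole product space. Since all paths of
  \<open>W\<close> are continuous, composing with \<open>regularize\<close> changes nothing along
  them, and measurability is demanded of the composition only.\<close>

lemma nn_integral_shift:
  assumes "(\<lambda>f. F (regularize f)) \<in> borel_measurable (PiM UNIV (\<lambda>_. borel))"
  shows "(\<integral>\<^sup>+x. F (\<lambda>u. W (u + v) x) \<partial>N) = (\<integral>\<^sup>+x. F (\<lambda>u. W u x) \<partial>N)"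
proof -
  have c: "continuous_on UNIV (\<lambda>u. W (u + v) x)" if "x \<in> space N" for x
    by (rule continuous_on_compose2[OF W_continuous[OF that], of UNIV "\<lambda>u. u + v"]) (auto intro!: continuous_intros)
  have "(\<integral>\<^sup>+x. F (\<lambda>u. W (u + v) x) \<partial>N) = (\<integral>\<^sup>+x. F (regularize (\<lambda>u. W (u + v) x)) \<partial>N)"
    by (intro nn_integral_cong) (simp add: regularize_continuous c)
  also have "\<dots> = (\<integral>\<^sup>+x. F (regularize (\<lambda>u. W u x)) \<partial>N)"
    by (rule W_stationary) fact
  also have "\<dots> = (\<integral>\<^sup>+x. F (\<lambda>u. W u x) \<partial>N)"
    by (intro nn_integral_cong) (simp add: regularize_continuous W_continuous)
  finally show ?thesis .
qed

text \<open>With \<open>A = UNIV\<close>, the choices \<open>J = {0<..}\<close> and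
  \<open>J = {0<..\<xi>}\<close> give the volumes of the sets \<open>E\<close> and \<open>B\<close>
  of the overview.\<close>

definition occ :: "'a set \<Rightarrow> real set \<Rightarrow> 'c \<Rightarrow> ennreal" where
  "occ A J x = emeasure lborel {u\<in>A. W u x \<in> J}"

lemma occ_sets [measurable]:
  assumes [measurable]: "A \<in> sets borel" "J \<in> sets borel" and x: "x \<in> space N"
  shows "{u\<in>A. W u x \<in> J} \<in> sets borel"
proof -
  have [measurable]: "(\<lambda>u. W u x) \<in> borel_measurable borel"
    by (rule borel_measurable_continuous_onI) (rule W_continuous[OF x])
  have "{u\<in>space borel. u \<in> A \<and> W u x \<in> J} \<in> sets borel" by measurable
  then show ?thesis by simp
qed

lemma occ_measurable [measurable]:
  assumes [measurable]: "A \<in> sets borel" "J \<in> sets borel"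
  shows "occ A J \<in> borel_measurable N"
proof -
  have "{p \<in> space (N \<Otimes>\<^sub>M lborel). snd p \<in> A \<and> (case p of (x, u) \<Rightarrow> W u x) \<in> J} \<in> sets (N \<Otimes>\<^sub>M lborel)"
    by measurable
  from lborel.measurable_emeasure_Pair[OF this] show ?thesis
    by (rule measurable_cong[THEN iffD1, rotated])
      (auto simp: space_pair_measure vimage_def occ_def intro!: arg_cong[where f="emeasure lborel"])
qed

lemma occ_mono:
  "A \<subseteq> A' \<Longrightarrow> J \<subseteq> J' \<Longrightarrow> A' \<in> sets borel \<Longrightarrow> J' \<in> sets borel \<Longrightarrow> x \<in> space N \<Longrightarrow> occ A J x \<le> occ A' J' x"
  unfolding occ_def by (intro emeasure_mono) (auto intro: occ_sets)

lemma occ_shift: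
  assumes [measurable]: "A \<in> sets borel" "J \<in> sets borel" and x: "x \<in> space N"
  shows "emeasure lborel {u\<in>A. W (u + v) x \<in> J} = occ {u. u - v \<in> A} J x"
proof -
  have [measurable]: "{u. u - v \<in> A} \<in> sets borel" by measurable
  have "emeasure lborel {u. u + v \<in> {u \<in> {u. u - v \<in> A}. W u x \<in> J}} = occ {u. u - v \<in> A} J x"
    unfolding occ_def by (rule emeasure_lborel_translate) (rule occ_sets[OF _ _ x], measurable)
  then show ?thesis by simp
qed

text \<open>Tonelli turns averages over a base point \<open>u\<close> into occupation
  volumes.\<close>

lemma nn_integral_occ:
  assumes [measurable]: "Q \<in> sets borel" "J \<in> sets borel" "g \<in> borel_measurable N"
  shows "(\<integral>\<^sup>+u. indicator Q u * (\<integral>\<^sup>+x. indicator J (W u x) * g x \<partial>N) \<partial>lborel) = (\<integral>\<^sup>+x. occ Q J x * g x \<partial>N)"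
proof -
  have "(\<integral>\<^sup>+u. indicator Q u * (\<integral>\<^sup>+x. indicator J (W u x) * g x \<partial>N) \<partial>lborel)
      = (\<integral>\<^sup>+u. (\<integral>\<^sup>+x. indicator Q u * (indicator J (W u x) * g x) \<partial>N) \<partial>lborel)"
    by (simp add: nn_integral_cmult)
  also have "\<dots> = (\<integral>\<^sup>+x. (\<integral>\<^sup>+u. indicator Q u * (indicator J (W u x) * g x) \<partial>lborel) \<partial>N)"
    by (rule Fubini') measurable
  also have "\<dots> = (\<integral>\<^sup>+x. occ Q J x * g x \<partial>N)"
  proof (rule nn_integral_cong)
    fix x assume x: "x \<in> space N"
    have "(\<integral>\<^sup>+u. indicator Q u * (indicator J (W u x) * g x) \<partial>lborel) = (\<integral>\<^sup>+u. indicator {u\<in>Q. W u x \<in> J} u * g x \<partial>lborel)"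
      by (intro nn_integral_cong) (auto split: split_indicator)
    also have "\<dots> = (\<integral>\<^sup>+u. indicator {u\<in>Q. W u x \<in> J} u \<partial>lborel) * g x"
      by (intro nn_integral_multc) (use occ_sets[OF _ _ x] in simp)
    also have "\<dots> = occ Q J x * g x"
      by (subst nn_integral_indicator) (use occ_sets[OF _ _ x] in \<open>simp_all add: occ_def\<close>)
    finally show "(\<integral>\<^sup>+u. indicator Q u * (indicator J (W u x) * g x) \<partial>lborel) = occ Q J x * g x" .
  qed
  finally show ?thesis .
qed

text \<open>Positive volume replaces a positive supremum: it is directly measurable, and for
  continuous paths on a cube the two conditions agree, as shown in
  \<open>hit_cube_eq\<close>.\<close>

definition hit :: "'a set \<Rightarrow> ennreal" where
  "hit Q = emeasure N {x\<in>space N. 0 < occ Q {0<..} x}"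

text \<open>Normalised intensity of the level set at the origin: the quantity estimated in the
  overview when \<open>A = UNIV\<close>, and a localised version when \<open>A\<close> is a bounded
  window.\<close>

definition density_at :: "'a set \<Rightarrow> real set \<Rightarrow> ennreal" where
  "density_at A J = (\<integral>\<^sup>+x. indicator J (W 0 x) * inverse (occ A J x) \<partial>N)"

text \<open>Stationarity moves the base point from 0 to \<open>v\<close>, the window being carried
  along.\<close>

lemma density_at_shift:
  assumes [measurable]: "A \<in> sets borel" "J \<in> sets borel"
  shows "(\<integral>\<^sup>+x. indicator J (W v x) * inverse (occ {u. u - v \<in> A} J x) \<partial>N) = density_at A J"
proof -
  have "(\<integral>\<^sup>+x. indicator J (W v x) * inverse (occ {u. u - v \<in> A} J x) \<partial>N)
     = (\<integral>\<^sup>+x. (\<lambda>f. indicator J (f 0) * inverse (emeasure lborel {u\<in>A. f u \<in> J})) (\<lambda>u. W (u + v) x) \<partial>N)"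
    by (intro nn_integral_cong) (simp add: occ_shift)
  also have "\<dots> = density_at A J"
    unfolding density_at_def occ_def by (rule nn_integral_shift) measurable
  finally show ?thesis .
qed

lemma hit_shift:
  assumes [measurable]: "Q \<in> sets borel"
  shows "hit {u. u - v \<in> Q} = hit Q"
proof -
  have [measurable]: "{u. u - v \<in> Q} \<in> sets borel" by measurable
  have eq: "hit Q = (\<integral>\<^sup>+x. indicator {0<..} (occ Q {0<..} x) \<partial>N)" if [measurable]: "Q \<in> sets borel" for Q
  proof -
    have "(\<integral>\<^sup>+x. indicator {0<..} (occ Q {0<..} x) \<partial>N) = (\<integral>\<^sup>+x. indicator {x\<in>space N. 0 < occ Q {0<..} x} x \<partial>N)"
      by (intro nn_integral_cong) (auto split: split_indicator)
    then show ?thesis by (simp add: hit_def)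
  qed
  have "hit {u. u - v \<in> Q} = (\<integral>\<^sup>+x. (\<lambda>f. indicator {0<..} (emeasure lborel {u\<in>Q. f u \<in> {0<..}})) (\<lambda>u. W (u + v) x) \<partial>N)"
    unfolding eq[OF \<open>{u. u - v \<in> Q} \<in> sets borel\<close>]
    by (intro nn_integral_cong) (simp add: occ_shift del: greaterThan_iff)
  also have "\<dots> = hit Q"
    unfolding eq[OF assms] occ_def by (rule nn_integral_shift) measurable
  finally show ?thesis .
qed

text \<open>Pointwise the ratio is at most 1, and it is 0 wherever the excursion set has volume 0 in
  \<open>Q\<close>.\<close>

lemma nn_integral_occ_ratio_le_hit:
  assumes [measurable]: "Q \<in> sets borel" "A \<in> sets borel" "J \<in> sets borel" and "J \<subseteq> {0<..}" "Q \<subseteq> A"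
  shows "(\<integral>\<^sup>+x. occ Q J x * inverse (occ A J x) \<partial>N) \<le> hit Q"
proof -
  have "(\<integral>\<^sup>+x. occ Q J x * inverse (occ A J x) \<partial>N) \<le> (\<integral>\<^sup>+x. indicator {x\<in>space N. 0 < occ Q {0<..} x} x \<partial>N)"
  proof (rule nn_integral_mono)
    fix x assume x: "x \<in> space N"
    have "occ Q J x \<le> occ Q {0<..} x" "occ Q J x \<le> occ A J x"
      using assms x by (auto intro!: occ_mono)
    then show "occ Q J x * inverse (occ A J x) \<le> indicator {x\<in>space N. 0 < occ Q {0<..} x} x"
      using x ennreal_mult_inverse_le_1[of "occ Q J x" "occ A J x"]
      by (cases "occ Q {0<..} x = 0") (auto simp: zero_less_iff_neq_zero)
  qed
  then show ?thesis by (simp add: hit_def)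
qed

text \<open>Average the base point over \<open>Q\<close>: the window \<open>UNIV\<close> is
  translation invariant, so each \<open>u\<close> contributes the same intensity, and the average
  becomes a ratio of occupation volumes.\<close>

lemma density_at_le_hit:
  assumes [measurable]: "Q \<in> sets borel" "J \<in> sets borel" and "J \<subseteq> {0<..}"
  shows "emeasure lborel Q * density_at UNIV J \<le> hit Q"
proof -
  have "emeasure lborel Q * density_at UNIV J = (\<integral>\<^sup>+u. indicator Q u * density_at UNIV J \<partial>lborel)"
    by (simp add: nn_integral_multc)
  also have "\<dots> = (\<integral>\<^sup>+u. indicator Q u * (\<integral>\<^sup>+x. indicator J (W u x) * inverse (occ UNIV J x) \<partial>N) \<partial>lborel)"
    using density_at_shift[of UNIV J] by simp
  also have "\<dots> = (\<integral>\<^sup>+x. occ Q J x * inverse (occ UNIV J x) \<partial>N)"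
    by (rule nn_integral_occ) measurable
  also have "\<dots> \<le> hit Q" using assms by (intro nn_integral_occ_ratio_le_hit) auto
  finally show ?thesis .
qed

text \<open>A mass transport argument: every point of the excursion set sends its mass uniformly to the
  band, so both sets have the same intensity after normalisation by their total volume.\<close>

lemma density_at_positive_le:
  assumes fin: "AE x in N. occ UNIV {0<..} x < \<infinity>" and \<xi>: "0 < \<xi>"
  shows "density_at UNIV {0<..} \<le> density_at UNIV {0<..\<xi>}"
proof -
  let ?E = "{0<..} :: real set" and ?B = "{0<..\<xi>}"
  \<comment> \<open>Insert the factor \<open>occ UNIV ?B x * inverse (occ UNIV ?B x)\<close>, which
    is 1 for almost every \<open>x\<close> with \<open>W 0 x > 0\<close>.\<close>
  have "density_at UNIV ?E = (\<integral>\<^sup>+x. occ UNIV ?B x * (indicator ?E (W 0 x) * inverse (occ UNIV ?E x) * inverse (occ UNIV ?B x)) \<partial>N)"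
    unfolding density_at_def
  proof (rule nn_integral_cong_AE)
    show "AE x in N. indicator ?E (W 0 x) * inverse (occ UNIV ?E x) =
        occ UNIV ?B x * (indicator ?E (W 0 x) * inverse (occ UNIV ?E x) * inverse (occ UNIV ?B x))"
      using fin AE_space
    proof eventually_elim
      case (elim x)
      note x = elim(2)
      show ?case
      proof (cases "0 < W 0 x")
        case True
        \<comment> \<open>A path positive everywhere would have infinite excursion volume. So it
          takes a nonpositive value, and the intermediate value theorem puts it strictly inside the
          band somewhere.\<close>
        have "\<not> (\<forall>u. 0 < W u x)"
        proof
          assume "\<forall>u. 0 < W u x"
          then have "{u\<in>UNIV. W u x \<in> {0<..}} = UNIV" by auto
          then show False using elim(1) by (simp only: occ_def) simp
        qed
        then obtain v where v: "W v x \<le> 0" by (auto simp: not_less)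
        define c where "c = min (W 0 x) \<xi> / 2"
        have c: "0 < c" "c < \<xi>" "c \<le> W 0 x" using True \<xi> by (auto simp: c_def min_def)
        have "connected (range (\<lambda>u. W u x))"
          by (intro connected_continuous_image W_continuous x) (simp add: convex_connected)
        then have "c \<in> range (\<lambda>u. W u x)"
          by (rule connectedD_interval[OF _ rangeI[of _ v] rangeI[of _ 0]]) (use v c in auto)
        then obtain w where w: "W w x = c" by auto
        have "open ((\<lambda>u. W u x) -` {0<..<\<xi>})"
          using W_continuous[OF x] by (intro open_vimage) auto
        moreover have "w \<in> (\<lambda>u. W u x) -` {0<..<\<xi>}" using w c by auto
        ultimately have "0 < emeasure lborel ((\<lambda>u. W u x) -` {0<..<\<xi>})"
          by (intro emeasure_lborel_open_pos) auto
        also have "\<dots> \<le> occ UNIV ?B x"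
          unfolding occ_def by (intro emeasure_mono) (use occ_sets[OF _ _ x, of UNIV ?B] in auto)
        finally have "occ UNIV ?B x \<noteq> 0" by auto
        moreover have "occ UNIV ?B x < \<infinity>"
          using occ_mono[of UNIV UNIV ?B ?E x] x elim(1) by (auto simp: greaterThanAtMost_def)
        ultimately have "occ UNIV ?B x * inverse (occ UNIV ?B x) = 1"
          by (rule ennreal_mult_inverse_self)
        moreover have "occ UNIV ?B x * (e * inverse (occ UNIV ?B x)) = (occ UNIV ?B x * inverse (occ UNIV ?B x)) * e" for e
          by (simp only: mult_ac)
        ultimately show ?thesis by simp
      qed simp
    qed
  qed
  also have "\<dots> = (\<integral>\<^sup>+u. indicator UNIV u * (\<integral>\<^sup>+x. indicator ?B (W u x) * (indicator ?E (W 0 x) * inverse (occ UNIV ?E x) * inverse (occ UNIV ?B x)) \<partial>N) \<partial>lborel)"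
    by (rule nn_integral_occ[symmetric]) measurable
  \<comment> \<open>Shifting exchanges the roles of the two points: now the origin lies in the band
    and \<open>- u\<close> in the excursion set.\<close>
  also have "\<dots> = (\<integral>\<^sup>+u. (\<integral>\<^sup>+x. indicator ?E (W (- u) x) * (indicator ?B (W 0 x) * inverse (occ UNIV ?E x) * inverse (occ UNIV ?B x)) \<partial>N) \<partial>lborel)"
  proof (rule nn_integral_cong)
    fix u :: 'a
    let ?F = "\<lambda>f. indicator ?B (f 0) * (indicator ?E (f (- u)) * inverse (emeasure lborel {u\<in>UNIV. f u \<in> ?E}) * inverse (emeasure lborel {u\<in>UNIV. f u \<in> ?B})) :: ennreal"
    have "(\<integral>\<^sup>+x. indicator ?B (W u x) * (indicator ?E (W 0 x) * inverse (occ UNIV ?E x) * inverse (occ UNIV ?B x)) \<partial>N)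
      = (\<integral>\<^sup>+x. ?F (\<lambda>w. W (w + u) x) \<partial>N)"
    proof (rule nn_integral_cong)
      fix x assume "x \<in> space N"
      then show "indicator ?B (W u x) * (indicator ?E (W 0 x) * inverse (occ UNIV ?E x) * inverse (occ UNIV ?B x))
        = ?F (\<lambda>w. W (w + u) x)"
        using occ_shift[of UNIV ?E x u] occ_shift[of UNIV ?B x u] by simp
    qed
    also have "\<dots> = (\<integral>\<^sup>+x. ?F (\<lambda>w. W w x) \<partial>N)"
      by (rule nn_integral_shift) measurable
    also have "\<dots> = (\<integral>\<^sup>+x. indicator ?E (W (- u) x) * (indicator ?B (W 0 x) * inverse (occ UNIV ?E x) * inverse (occ UNIV ?B x)) \<partial>N)"
      by (intro nn_integral_cong) (simp add: occ_def mult_ac)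
    finally show "indicator UNIV u * (\<integral>\<^sup>+x. indicator ?B (W u x) * (indicator ?E (W 0 x) * inverse (occ UNIV ?E x) * inverse (occ UNIV ?B x)) \<partial>N)
      = (\<integral>\<^sup>+x. indicator ?E (W (- u) x) * (indicator ?B (W 0 x) * inverse (occ UNIV ?E x) * inverse (occ UNIV ?B x)) \<partial>N)"
      by simp
  qed
  also have "\<dots> = (\<integral>\<^sup>+u. indicator UNIV u * (\<integral>\<^sup>+x. indicator ?E (W u x) * (indicator ?B (W 0 x) * inverse (occ UNIV ?E x) * inverse (occ UNIV ?B x)) \<partial>N) \<partial>lborel)"
    by (subst nn_integral_lborel_reflect) simp_all
  also have "\<dots> = (\<integral>\<^sup>+x. occ UNIV ?E x * (indicator ?B (W 0 x) * inverse (occ UNIV ?E x) * inverse (occ UNIV ?B x)) \<partial>N)"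
    by (rule nn_integral_occ) measurable
  \<comment> \<open>The mass received from the excursion set is a ratio of equal volumes, hence at
    most 1.\<close>
  also have "\<dots> \<le> density_at UNIV ?B"
    unfolding density_at_def
  proof (rule nn_integral_mono)
    fix x
    have "(occ UNIV ?E x * inverse (occ UNIV ?E x)) * (indicator ?B (W 0 x) * inverse (occ UNIV ?B x)) \<le> 1 * (indicator ?B (W 0 x) * inverse (occ UNIV ?B x))"
      by (intro mult_right_mono ennreal_mult_inverse_le_1) auto
    then show "occ UNIV ?E x * (indicator ?B (W 0 x) * inverse (occ UNIV ?E x) * inverse (occ UNIV ?B x)) \<le> indicator ?B (W 0 x) * inverse (occ UNIV ?B x)"
      by (simp add: mult_ac)
  qed
  finally show ?thesis .
qed


section \<open>Comparison of the hitting mass of large cubes with local intensities\<close>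

text \<open>For a base point in the cell, its cubic window of half side \<open>r\<close> is
  contained in \<open>D\<close>, so replacing \<open>D\<close> by the window only increases the
  inverse volume. Stationarity then makes the bound independent of the base point.\<close>

lemma density_at_cube_le:
  assumes r: "0 < r" and [measurable]: "D \<in> sets borel"
    and D: "\<And>u v. u \<in> cbox a (a + r *\<^sub>R One) \<Longrightarrow> v - u \<in> cbox (- r *\<^sub>R One) (r *\<^sub>R One) \<Longrightarrow> v \<in> D"
  shows "(\<integral>\<^sup>+x. occ (cbox a (a + r *\<^sub>R One)) {0<..} x * inverse (occ D {0<..} x) \<partial>N)
    \<le> ennreal (r ^ DIM('a)) * density_at (cbox (- r *\<^sub>R One) (r *\<^sub>R One)) {0<..}"
proof -
  let ?Q = "cbox a (a + r *\<^sub>R One)" and ?C = "cbox (- r *\<^sub>R One) (r *\<^sub>R One) :: 'a set"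
  have "(\<integral>\<^sup>+x. occ ?Q {0<..} x * inverse (occ D {0<..} x) \<partial>N)
     = (\<integral>\<^sup>+u. indicator ?Q u * (\<integral>\<^sup>+x. indicator {0<..} (W u x) * inverse (occ D {0<..} x) \<partial>N) \<partial>lborel)"
    by (rule nn_integral_occ[symmetric]) measurable
  also have "\<dots> \<le> (\<integral>\<^sup>+u. indicator ?Q u * density_at ?C {0<..} \<partial>lborel)"
  proof (rule nn_integral_mono)
    fix u :: 'a
    have "(\<integral>\<^sup>+x. indicator {0<..} (W u x) * inverse (occ D {0<..} x) \<partial>N)
       \<le> (\<integral>\<^sup>+x. indicator {0<..} (W u x) * inverse (occ {v. v - u \<in> ?C} {0<..} x) \<partial>N)" if "u \<in> ?Q"
      by (intro nn_integral_mono mult_left_mono ennreal_inverse_antimono occ_mono) (use D[OF that] in auto)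
    then show "indicator ?Q u * (\<integral>\<^sup>+x. indicator {0<..} (W u x) * inverse (occ D {0<..} x) \<partial>N) \<le> indicator ?Q u * density_at ?C {0<..}"
      using density_at_shift[of ?C "{0<..}" u] by (auto split: split_indicator)
  qed
  also have "\<dots> = ennreal (r ^ DIM('a)) * density_at ?C {0<..}"
    using r by (simp add: nn_integral_multc emeasure_cube)
  finally show ?thesis .
qed

text \<open>The window around any point of \<open>?Q\<close> contains \<open>?Q\<close> itself, so
  averaging bounds the intensity by a ratio of equal volumes and hence by \<open>hit\<close>. The
  finiteness later supplies the integrable majorant when windows grow.\<close>

lemma density_at_cube_finite:
  assumes r: "0 < r" and fin: "hit (cbox 0 (r *\<^sub>R One)) < \<infinity>"
  shows "density_at (cbox (- r *\<^sub>R One) (r *\<^sub>R One)) {0<..} < \<infinity>"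
proof -
  let ?Q = "cbox 0 (r *\<^sub>R One) :: 'a set" and ?C = "cbox (- r *\<^sub>R One) (r *\<^sub>R One) :: 'a set"
  have "emeasure lborel ?Q * density_at ?C {0<..} = (\<integral>\<^sup>+u. indicator ?Q u * density_at ?C {0<..} \<partial>lborel)"
    by (simp add: nn_integral_multc)
  also have "\<dots> = (\<integral>\<^sup>+u. indicator ?Q u * (\<integral>\<^sup>+x. indicator {0<..} (W u x) * inverse (occ {v. v - u \<in> ?C} {0<..} x) \<partial>N) \<partial>lborel)"
    by (subst density_at_shift) auto
  also have "\<dots> \<le> (\<integral>\<^sup>+u. indicator ?Q u * (\<integral>\<^sup>+x. indicator {0<..} (W u x) * inverse (occ ?Q {0<..} x) \<partial>N) \<partial>lborel)"
  proof (rule nn_integral_mono)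
    fix u :: 'a
    have "(\<integral>\<^sup>+x. indicator {0<..} (W u x) * inverse (occ {v. v - u \<in> ?C} {0<..} x) \<partial>N)
       \<le> (\<integral>\<^sup>+x. indicator {0<..} (W u x) * inverse (occ ?Q {0<..} x) \<partial>N)" if u: "u \<in> ?Q"
    proof (intro nn_integral_mono mult_left_mono ennreal_inverse_antimono occ_mono)
      show "?Q \<subseteq> {v. v - u \<in> ?C}"
      proof
        fix v assume v: "v \<in> ?Q"
        have "- r \<le> v \<bullet> b - u \<bullet> b \<and> v \<bullet> b - u \<bullet> b \<le> r" if b: "b \<in> Basis" for b
          using u[unfolded mem_box, rule_format, OF b] v[unfolded mem_box, rule_format, OF b] b by simp
        then show "v \<in> {v. v - u \<in> ?C}" by (simp add: mem_box inner_simps)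
      qed
    qed auto
    then show "indicator ?Q u * (\<integral>\<^sup>+x. indicator {0<..} (W u x) * inverse (occ {v. v - u \<in> ?C} {0<..} x) \<partial>N)
       \<le> indicator ?Q u * (\<integral>\<^sup>+x. indicator {0<..} (W u x) * inverse (occ ?Q {0<..} x) \<partial>N)"
      by (auto split: split_indicator)
  qed
  also have "\<dots> = (\<integral>\<^sup>+x. occ ?Q {0<..} x * inverse (occ ?Q {0<..} x) \<partial>N)"
    by (rule nn_integral_occ) measurable
  also have "\<dots> \<le> hit ?Q" by (rule nn_integral_occ_ratio_le_hit) auto
  finally have "ennreal (r ^ DIM('a)) * density_at ?C {0<..} < \<infinity>"
    using fin r emeasure_cube[of r 0] by auto
  then show ?thesis
    using r zero_less_power[OF r, of "DIM('a)"] by (auto simp: ennreal_mult_less_top ennreal_eq_0_iff simp del: zero_less_power)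
qed

text \<open>On the hitting event the ratios of cell volume to total volume sum to at least 1. Cells
  away from the boundary are treated with \<open>density_at_cube_le\<close>, the remaining ones with
  the crude bound by \<open>hit\<close>.\<close>

lemma hit_le_grid:
  assumes r: "0 < r" and n: "2 \<le> n"
  shows "hit (cbox 0 ((real n * r) *\<^sub>R One)) \<le>
    of_nat ((n - 2) ^ DIM('a)) * (ennreal (r ^ DIM('a)) * density_at (cbox (- r *\<^sub>R One) (r *\<^sub>R One)) {0<..})
    + of_nat (n ^ DIM('a) - (n - 2) ^ DIM('a)) * hit (cbox 0 (r *\<^sub>R One))"
proof -
  let ?E = "{0<..} :: real set"
  define Q where "Q = (cbox 0 ((real n * r) *\<^sub>R One) :: 'a set)"
  define a where "a k = (\<Sum>b\<in>Basis. (r * real (k b)) *\<^sub>R b)" for k :: "'a \<Rightarrow> nat"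
  define C where "C k = cbox (a k) (a k + r *\<^sub>R One)" for k
  define T where "T = PiE (Basis :: 'a set) (\<lambda>_. {..<n})"
  \<comment> \<open>Interior cells: a margin of one cell on every side keeps the windows of half
    side \<open>r\<close> inside \<open>Q\<close>.\<close>
  define T' where "T' = PiE (Basis :: 'a set) (\<lambda>_. {1..<n-1})"
  have ab: "a k \<bullet> b = r * real (k b)" if "b \<in> Basis" for k b
    using that by (simp add: a_def)
  have fT: "finite T" and T'T: "T' \<subseteq> T"
    unfolding T_def T'_def by (auto intro!: finite_PiE PiE_mono)
  have card: "card T = n ^ DIM('a)" "card T' = (n - 2) ^ DIM('a)"
    unfolding T_def T'_def by (simp_all add: card_PiE numeral_2_eq_2)
  have [measurable]: "Q \<in> sets borel" "\<And>k. C k \<in> sets borel" by (auto simp: Q_def C_def)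
  have memC: "u \<in> C k \<longleftrightarrow> (\<forall>b\<in>Basis. r * real (k b) \<le> u \<bullet> b \<and> u \<bullet> b \<le> r * real (k b) + r)" for u k
    by (auto simp: C_def mem_box ab inner_simps)
  have memQ: "u \<in> Q \<longleftrightarrow> (\<forall>b\<in>Basis. 0 \<le> u \<bullet> b \<and> u \<bullet> b \<le> real n * r)" for u
    by (auto simp: Q_def mem_box)
  have cover: "Q \<subseteq> (\<Union>k\<in>T. C k)"
  proof
    fix u assume u: "u \<in> Q"
    \<comment> \<open>The minimum with \<open>n - 1\<close> assigns points of the upper faces, where
      the quotient is \<open>n\<close>, to the last cell.\<close>
    define k where "k = restrict (\<lambda>b. min (n - 1) (nat \<lfloor>u \<bullet> b / r\<rfloor>)) (Basis :: 'a set)"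
    have "k \<in> T" using n by (auto simp: T_def k_def)
    moreover have "u \<in> C k"
      unfolding memC
    proof
      fix b :: 'a assume b: "b \<in> Basis"
      define t where "t = u \<bullet> b / r"
      have t: "0 \<le> t" "t \<le> real n" "u \<bullet> b = r * t"
        using u b r by (auto simp: memQ t_def divide_simps mult.commute)
      have k: "k b = min (n - 1) (nat \<lfloor>t\<rfloor>)" using b by (simp add: k_def t_def)
      have "real (k b) \<le> t" "t \<le> real (k b) + 1"
        using t n unfolding k by (auto simp: min_def le_nat_floor of_nat_diff) linarith+
      then have "r * real (k b) \<le> r * t" "r * t \<le> r * (real (k b) + 1)"
        using r by (auto intro!: mult_left_mono)
      then show "r * real (k b) \<le> u \<bullet> b \<and> u \<bullet> b \<le> r * real (k b) + r"
        by (simp add: t algebra_simps)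
    qed
    ultimately show "u \<in> (\<Union>k\<in>T. C k)" by auto
  qed
  have CQ: "C k \<subseteq> Q" if k: "k \<in> T" for k
  proof
    fix u assume u: "u \<in> C k"
    show "u \<in> Q" unfolding memQ
    proof
      fix b :: 'a assume b: "b \<in> Basis"
      have "real (k b) + 1 \<le> real n" using k b by (auto simp: T_def PiE_iff)
      then have "r * (real (k b) + 1) \<le> r * real n" using r by (intro mult_left_mono) auto
      moreover have "0 \<le> r * real (k b)" using r by simp
      moreover have "r * real (k b) \<le> u \<bullet> b \<and> u \<bullet> b \<le> r * real (k b) + r"
        using u b by (simp add: memC)
      ultimately show "0 \<le> u \<bullet> b \<and> u \<bullet> b \<le> real n * r"
        using order_trans[of 0 "r * real (k b)" "u \<bullet> b"] by (simp add: algebra_simps)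
    qed
  qed
  have interior: "(\<integral>\<^sup>+x. occ (C k) ?E x * inverse (occ Q ?E x) \<partial>N)
      \<le> ennreal (r ^ DIM('a)) * density_at (cbox (- r *\<^sub>R One) (r *\<^sub>R One)) ?E" if k: "k \<in> T'" for k
    unfolding C_def
  proof (rule density_at_cube_le[OF r])
    fix u v :: 'a
    assume u: "u \<in> cbox (a k) (a k + r *\<^sub>R One)" and v: "v - u \<in> cbox (- r *\<^sub>R One) (r *\<^sub>R One)"
    show "v \<in> Q" unfolding memQ
    proof
      fix b :: 'a assume b: "b \<in> Basis"
      have "1 \<le> real (k b)" "real (k b) + 2 \<le> real n" using k b by (auto simp: T'_def PiE_iff)
      then have "r * 1 \<le> r * real (k b)" "r * (real (k b) + 2) \<le> r * real n" using r by (auto intro!: mult_left_mono)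
      moreover have "r * real (k b) \<le> u \<bullet> b \<and> u \<bullet> b \<le> r * real (k b) + r"
        using u b by (simp add: memC[unfolded C_def])
      moreover have "- r \<le> v \<bullet> b - u \<bullet> b" "v \<bullet> b - u \<bullet> b \<le> r"
        using v b by (simp_all add: mem_box inner_simps)
      ultimately show "0 \<le> v \<bullet> b \<and> v \<bullet> b \<le> real n * r"
        by (simp add: algebra_simps)
    qed
  qed simp
  have hitC: "hit (C k) = hit (cbox 0 (r *\<^sub>R One))" for k
  proof -
    have "C k = {u. u - a k \<in> cbox 0 (r *\<^sub>R One)}"
      by (simp add: set_eq_iff C_def mem_box inner_simps diff_le_eq add.commute)
    then show ?thesis using hit_shift[of "cbox 0 (r *\<^sub>R One)" "a k"] by simp
  qed
  have boundary: "(\<integral>\<^sup>+x. occ (C k) ?E x * inverse (occ Q ?E x) \<partial>N) \<le> hit (cbox 0 (r *\<^sub>R One))" if "k \<in> T" for k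
    unfolding hitC[of k, symmetric] by (rule nn_integral_occ_ratio_le_hit) (use CQ[OF that] in auto)
  have "hit Q = (\<integral>\<^sup>+x. indicator {x\<in>space N. 0 < occ Q ?E x} x \<partial>N)"
    by (simp add: hit_def)
  also have "\<dots> \<le> (\<integral>\<^sup>+x. (\<Sum>k\<in>T. occ (C k) ?E x * inverse (occ Q ?E x)) \<partial>N)"
  proof (rule nn_integral_mono)
    fix x assume x: "x \<in> space N"
    show "indicator {x\<in>space N. 0 < occ Q ?E x} x \<le> (\<Sum>k\<in>T. occ (C k) ?E x * inverse (occ Q ?E x))"
    proof (cases "0 < occ Q ?E x")
      case True
      have "occ Q ?E x \<le> emeasure lborel Q"
        unfolding occ_def by (intro emeasure_mono) auto
      also have "\<dots> < \<infinity>" unfolding Q_def by (rule emeasure_lborel_cbox_finite)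
      finally have "1 = occ Q ?E x * inverse (occ Q ?E x)"
        using True by (subst ennreal_mult_inverse_self) auto
      moreover have "occ Q ?E x \<le> (\<Sum>k\<in>T. occ (C k) ?E x)"
      proof -
        have sets: "{u\<in>C k. W u x \<in> ?E} \<in> sets lborel" for k
          using occ_sets[OF _ _ x, of "C k" ?E] by simp
        have "occ Q ?E x \<le> emeasure lborel (\<Union>k\<in>T. {u\<in>C k. W u x \<in> ?E})"
          unfolding occ_def
        proof (rule emeasure_mono)
          show "{u\<in>Q. W u x \<in> ?E} \<subseteq> (\<Union>k\<in>T. {u\<in>C k. W u x \<in> ?E})" using cover by blast
          show "(\<Union>k\<in>T. {u\<in>C k. W u x \<in> ?E}) \<in> sets lborel" by (rule sets.finite_UN[OF fT sets])
        qed
        \<comment> \<open>The closed cells share faces, so subadditivity takes the place of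
          additivity.\<close>
        also have "\<dots> \<le> (\<Sum>k\<in>T. occ (C k) ?E x)"
          unfolding occ_def using sets by (intro emeasure_subadditive_finite fT) blast
        finally show ?thesis .
      qed
      then have "occ Q ?E x * inverse (occ Q ?E x) \<le> (\<Sum>k\<in>T. occ (C k) ?E x) * inverse (occ Q ?E x)"
        by (rule mult_right_mono) simp
      ultimately show ?thesis
        using True x by (simp add: sum_distrib_right)
    qed simp
  qed
  also have "\<dots> = (\<Sum>k\<in>T. \<integral>\<^sup>+x. occ (C k) ?E x * inverse (occ Q ?E x) \<partial>N)"
    by (rule nn_integral_sum) measurable
  also have "\<dots> = (\<Sum>k\<in>T'. \<integral>\<^sup>+x. occ (C k) ?E x * inverse (occ Q ?E x) \<partial>N) + (\<Sum>k\<in>T-T'. \<integral>\<^sup>+x. occ (C k) ?E x * inverse (occ Q ?E x) \<partial>N)"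
    using sum.subset_diff[OF T'T fT] by (simp add: add.commute)
  also have "\<dots> \<le> (\<Sum>k\<in>T'. ennreal (r ^ DIM('a)) * density_at (cbox (- r *\<^sub>R One) (r *\<^sub>R One)) ?E) + (\<Sum>k\<in>T-T'. hit (cbox 0 (r *\<^sub>R One)))"
    by (intro add_mono sum_mono interior boundary) auto
  also have "\<dots> = of_nat ((n - 2) ^ DIM('a)) * (ennreal (r ^ DIM('a)) * density_at (cbox (- r *\<^sub>R One) (r *\<^sub>R One)) ?E)
    + of_nat (n ^ DIM('a) - (n - 2) ^ DIM('a)) * hit (cbox 0 (r *\<^sub>R One))"
    using card_Diff_subset[OF finite_subset[OF T'T fT] T'T] by (simp add: card)
  finally show ?thesis by (simp add: Q_def)
qed


text \<open>Take \<open>m = n * r\<close> in the limit and divide the grid estimate by the volume: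
  the interior fraction tends to 1 and the boundary fraction to 0.\<close>

lemma limit_le_density_at_cube:
  assumes r: "0 < r" and hit: "hit (cbox 0 (r *\<^sub>R One)) < \<infinity>"
    and lim: "((\<lambda>m::real. ennreal (1 / m ^ DIM('a)) * hit (cbox 0 (m *\<^sub>R One))) \<longlongrightarrow> K) at_top"
  shows "K \<le> density_at (cbox (- r *\<^sub>R One) (r *\<^sub>R One)) {0<..}"
proof -
  let ?d = "DIM('a)"
  let ?h = "density_at (cbox (- r *\<^sub>R One) (r *\<^sub>R One)) {0<..}"
  obtain h where h: "0 \<le> h" "?h = ennreal h"
    using density_at_cube_finite[OF r hit] by (cases ?h) auto
  obtain c where c: "0 \<le> c" "hit (cbox 0 (r *\<^sub>R One)) = ennreal c"
    using hit by (cases "hit (cbox 0 (r *\<^sub>R One))") auto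
  define q where "q n = (real n - 2) / real n" for n
  \<comment> \<open>The grid bound after division: a weighted mean of the local intensity
    \<open>h\<close> and the cost per volume of a boundary cell.\<close>
  define R where "R n = q n ^ ?d * h + (1 - q n ^ ?d) * (c / r ^ ?d)" for n
  have "q \<longlonglongrightarrow> 1" unfolding q_def by real_asymp
  then have "R \<longlonglongrightarrow> 1 ^ ?d * h + (1 - 1 ^ ?d) * (c / r ^ ?d)"
    unfolding R_def by (intro tendsto_intros)
  then have R: "(\<lambda>n. ennreal (R n)) \<longlonglongrightarrow> ?h" unfolding h by (intro tendsto_ennrealI) simp
  have "filterlim (\<lambda>n. real n * r) at_top sequentially"
    using r by real_asymp
  from filterlim_compose[OF lim this]
  have L: "(\<lambda>n. ennreal (1 / (real n * r) ^ ?d) * hit (cbox 0 ((real n * r) *\<^sub>R One))) \<longlonglongrightarrow> K" .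
  show ?thesis
  proof (rule LIMSEQ_le[OF L R], intro exI allI impI)
    fix n :: nat assume n: "2 \<le> n"
    have le: "(n - 2) ^ ?d \<le> n ^ ?d" by (intro power_mono) auto
    have "hit (cbox 0 ((real n * r) *\<^sub>R One)) \<le>
      of_nat ((n - 2) ^ ?d) * (ennreal (r ^ ?d) * ?h) + of_nat (n ^ ?d - (n - 2) ^ ?d) * hit (cbox 0 (r *\<^sub>R One))"
      by (rule hit_le_grid[OF r n])
    also have "\<dots> = ennreal ((real n - 2) ^ ?d * (r ^ ?d * h) + (real n ^ ?d - (real n - 2) ^ ?d) * c)"
    proof -
      have 1: "(of_nat ((n - 2) ^ ?d) :: ennreal) = ennreal ((real n - 2) ^ ?d)"
        using n by (simp add: ennreal_of_nat_eq_real_of_nat of_nat_diff del: of_nat_power) (simp add: of_nat_diff)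
      have 2: "(of_nat (n ^ ?d - (n - 2) ^ ?d) :: ennreal) = ennreal (real n ^ ?d - (real n - 2) ^ ?d)"
        using n le by (simp add: ennreal_of_nat_eq_real_of_nat of_nat_diff)
      have "(real n - 2) ^ ?d \<le> real n ^ ?d" using n by (intro power_mono) auto
      then show ?thesis
        unfolding 1 2 h c using h(1) c(1) r n by (simp add: ennreal_mult[symmetric] ennreal_plus[symmetric] del: ennreal_plus)
    qed
    finally have "ennreal (1 / (real n * r) ^ ?d) * hit (cbox 0 ((real n * r) *\<^sub>R One)) \<le>
      ennreal (1 / (real n * r) ^ ?d) * ennreal ((real n - 2) ^ ?d * (r ^ ?d * h) + (real n ^ ?d - (real n - 2) ^ ?d) * c)"
      by (rule mult_left_mono) simp
    also have "\<dots> = ennreal (1 / (real n * r) ^ ?d * ((real n - 2) ^ ?d * (r ^ ?d * h) + (real n ^ ?d - (real n - 2) ^ ?d) * c))"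
      by (subst ennreal_mult') (use r in auto)
    also have "1 / (real n * r) ^ ?d * ((real n - 2) ^ ?d * (r ^ ?d * h) + (real n ^ ?d - (real n - 2) ^ ?d) * c) = R n"
      using r n by (simp add: R_def q_def power_mult_distrib power_divide field_simps)
    finally show "ennreal (1 / (real n * r) ^ ?d) * hit (cbox 0 ((real n * r) *\<^sub>R One)) \<le> ennreal (R n)" .
  qed
qed

text \<open>The upper bound holds for each positive side length before the limit. For the lower
  bound the windows grow to the whole space, and mass transport passes from the excursion set to the
  band.\<close>

lemma density_at_eq_limit:
  assumes fin: "AE x in N. occ UNIV {0<..} x < \<infinity>"
    and hit: "\<And>r. 0 < r \<Longrightarrow> hit (cbox 0 (r *\<^sub>R One)) < \<infinity>"
    and lim: "((\<lambda>m::real. ennreal (1 / m ^ DIM('a)) * hit (cbox 0 (m *\<^sub>R One))) \<longlongrightarrow> K) at_top"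
    and \<xi>: "0 < \<xi>"
  shows "density_at UNIV {0<..\<xi>} = K"
proof (rule antisym)
  show "density_at UNIV {0<..\<xi>} \<le> K"
  proof (rule tendsto_lowerbound[OF lim])
    show "\<forall>\<^sub>F m in at_top. density_at UNIV {0<..\<xi>} \<le> ennreal (1 / m ^ DIM('a)) * hit (cbox 0 (m *\<^sub>R One))"
      using eventually_gt_at_top[of 0]
    proof eventually_elim
      case (elim m)
      have "ennreal (1 / m ^ DIM('a)) * (ennreal (m ^ DIM('a)) * density_at UNIV {0<..\<xi>}) \<le> ennreal (1 / m ^ DIM('a)) * hit (cbox 0 (m *\<^sub>R One))"
        using density_at_le_hit[of "cbox 0 (m *\<^sub>R One)" "{0<..\<xi>}"] emeasure_cube[of m 0] elim
        by (intro mult_left_mono) (auto simp: greaterThanAtMost_def)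
      moreover have "ennreal (1 / m ^ DIM('a)) * ennreal (m ^ DIM('a)) = 1"
        using elim by (simp add: ennreal_mult[symmetric])
      ultimately show ?case by (simp add: mult.assoc[symmetric])
    qed
  qed simp
  \<comment> \<open>Half sides start at 1, so that already the first window gives a finite
    integral.\<close>
  define C where "C i = (cbox (- real (Suc i) *\<^sub>R One) (real (Suc i) *\<^sub>R One) :: 'a set)" for i
  have [measurable]: "C i \<in> sets borel" for i by (simp add: C_def)
  have mono: "C i \<subseteq> C j" if "i \<le> j" for i j
    unfolding C_def using that by (intro subset_box_imp) (auto simp: inner_simps)
  define f where "f i x = indicator {0<..} (W 0 x) * inverse (occ (C i) {0<..} x)" for i x
  have "K \<le> density_at (C i) {0<..}" for i
    unfolding C_def by (rule limit_le_density_at_cube[OF _ hit lim]) auto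
  then have "K \<le> (INF i. integral\<^sup>N N (f i))"
    by (auto simp: density_at_def f_def[abs_def] intro!: INF_greatest)
  \<comment> \<open>Larger windows give smaller inverses; monotone convergence for decreasing
    sequences uses the finite integral of \<open>f 0\<close>.\<close>
  also have "\<dots> = (\<integral>\<^sup>+x. (INF i. f i x) \<partial>N)"
  proof (rule nn_integral_monotone_convergence_INF_AE[symmetric, where i=0])
    show "AE x in N. f (Suc i) x \<le> f i x" for i
      unfolding f_def by (intro AE_I2 mult_left_mono ennreal_inverse_antimono occ_mono mono) auto
    show "f i \<in> borel_measurable N" for i unfolding f_def by measurable
    show "(\<integral>\<^sup>+x. f 0 x \<partial>N) < \<infinity>"
      using density_at_cube_finite[of 1] hit[of 1] by (simp add: f_def C_def density_at_def)
  qed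
  also have "\<dots> \<le> density_at UNIV {0<..}"
    unfolding density_at_def
  proof (rule nn_integral_mono)
    fix x assume x: "x \<in> space N"
    have "(\<Union>i. C i) = UNIV"
    proof -
      have "u \<in> C (nat \<lceil>norm u\<rceil>)" for u
      proof -
        have "\<bar>u \<bullet> b\<bar> \<le> 1 + real (nat \<lceil>norm u\<rceil>)" if "b \<in> Basis" for b
          using Basis_le_norm[OF that, of u] by linarith
        then show ?thesis by (force simp: C_def mem_box abs_le_iff)
      qed
      then show ?thesis by blast
    qed
    then have U: "(\<Union>i. {u\<in>C i. W u x \<in> {0<..}}) = {u\<in>UNIV. W u x \<in> {0<..}}" by blast
    have "(\<lambda>i. occ (C i) {0<..} x) \<longlonglongrightarrow> occ UNIV {0<..} x"
    proof -
      have "incseq (\<lambda>i. {u\<in>C i. W u x \<in> {0<..}})" using mono unfolding incseq_def by blast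
      moreover have "range (\<lambda>i. {u\<in>C i. W u x \<in> {0<..}}) \<subseteq> sets lborel"
        using occ_sets[OF _ _ x, of "C i" "{0<..}" for i] by auto
      ultimately show ?thesis
        unfolding occ_def using Lim_emeasure_incseq[of "\<lambda>i. {u\<in>C i. W u x \<in> {0<..}}" lborel] U by metis
    qed
    then have "(\<lambda>i. inverse (occ (C i) {0<..} x)) \<longlonglongrightarrow> inverse (occ UNIV {0<..} x)"
      by (rule continuous_on_tendsto_compose[OF continuous_on_inverse_ennreal[OF continuous_on_id, of UNIV]]) auto
    then have "(INF i. inverse (occ (C i) {0<..} x)) \<le> inverse (occ UNIV {0<..} x)"
      by (rule LIMSEQ_le_const) (auto intro: INF_lower)
    moreover have "(INF i. f i x) = indicator {0<..} (W 0 x) * (INF i. inverse (occ (C i) {0<..} x))"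
      by (auto simp: f_def split: split_indicator)
    ultimately show "(INF i. f i x) \<le> indicator {0<..} (W 0 x) * inverse (occ UNIV {0<..} x)"
      by (simp add: mult_left_mono)
  qed
  also have "\<dots> \<le> density_at UNIV {0<..\<xi>}" by (rule density_at_positive_le[OF fin \<xi>])
  finally show "K \<le> density_at UNIV {0<..\<xi>}" .
qed

end

section \<open>Gaussian fields and Fernique's tail bound\<close>

text \<open>Completing the square turns the tilted density into a multiple of the normal density
  with mean \<open>\<mu> + v\<close>; zero variance is the constant case.\<close>

lemma gaussian_rv_mgf:
  assumes M: "prob_space M" and X: "gaussian_rv M X \<mu> v"
  shows "(\<integral>\<^sup>+\<omega>. ennreal (exp (X \<omega>)) \<partial>M) = ennreal (exp (\<mu> + v / 2))"
proof (cases "v = 0")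
  case True
  interpret prob_space M by fact
  have "AE \<omega> in M. X \<omega> = \<mu>" using X True by (simp add: gaussian_rv_def)
  then have "(\<integral>\<^sup>+\<omega>. ennreal (exp (X \<omega>)) \<partial>M) = (\<integral>\<^sup>+\<omega>. ennreal (exp \<mu>) \<partial>M)"
    by (intro nn_integral_cong_AE) auto
  then show ?thesis using True by (simp add: emeasure_space_1)
next
  case False
  then have v: "0 < v" and dist: "distributed M lborel X (normal_density \<mu> (sqrt v))"
    using X by (auto simp: gaussian_rv_def)
  interpret G: prob_space "density lborel (normal_density (\<mu> + v) (sqrt v))"
    by (rule prob_space_normal_density) (use v in simp)
  have *: "normal_density \<mu> (sqrt v) x * exp x = exp (\<mu> + v / 2) * normal_density (\<mu> + v) (sqrt v) x" for x
  proof -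
    have "- (x - \<mu>)\<^sup>2 / (2 * v) + x = (\<mu> + v / 2) + - (x - (\<mu> + v))\<^sup>2 / (2 * v)"
      using v by (simp add: field_simps power2_eq_square)
    then show ?thesis
      using v by (simp add: normal_density_def exp_add[symmetric])
  qed
  have "(\<integral>\<^sup>+\<omega>. ennreal (exp (X \<omega>)) \<partial>M) = (\<integral>\<^sup>+x. ennreal (normal_density \<mu> (sqrt v) x) * ennreal (exp x) \<partial>lborel)"
    by (rule distributed_nn_integral[OF dist, symmetric]) simp
  also have "\<dots> = (\<integral>\<^sup>+x. ennreal (exp (\<mu> + v / 2)) * ennreal (normal_density (\<mu> + v) (sqrt v) x) \<partial>lborel)"
    by (simp add: ennreal_mult'[symmetric] * flip: ennreal_mult'')
  also have "\<dots> = ennreal (exp (\<mu> + v / 2)) * (\<integral>\<^sup>+x. ennreal (normal_density (\<mu> + v) (sqrt v) x) \<partial>lborel)"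
    by (rule nn_integral_cmult) simp
  also have "(\<integral>\<^sup>+x. ennreal (normal_density (\<mu> + v) (sqrt v) x) \<partial>lborel) = 1"
    using G.emeasure_space_1 by (simp add: emeasure_density)
  finally show ?thesis by simp
qed

text \<open>The points \<open>p i\<close> may coincide, whereas the definition of a Gaussian field
  sums over a set of points; coefficients are therefore collected point by point. Coincidences do
  arise in \<open>tilted_law\<close>.\<close>

lemma gaussian_field_mgf:
  assumes "gaussian_field M Y m C" "finite I"
  shows "(\<integral>\<^sup>+\<omega>. ennreal (exp (\<Sum>i\<in>I. c i * Y (p i) \<omega>)) \<partial>M)
     = ennreal (exp ((\<Sum>i\<in>I. c i * m (p i)) + (\<Sum>i\<in>I. \<Sum>j\<in>I. c i * c j * C (p i) (p j)) / 2))"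
proof -
  define e where "e u = (\<Sum>i | i \<in> I \<and> p i = u. c i)" for u
  have group: "(\<Sum>u\<in>p ` I. e u * f u) = (\<Sum>i\<in>I. c i * f (p i))" for f :: "_ \<Rightarrow> real"
  proof -
    have "(\<Sum>i\<in>I. c i * f (p i)) = (\<Sum>u\<in>p ` I. \<Sum>i | i \<in> I \<and> p i = u. c i * f (p i))"
      by (rule sum.image_gen) fact
    also have "\<dots> = (\<Sum>u\<in>p ` I. e u * f u)"
      by (intro sum.cong refl) (auto simp: e_def sum_distrib_right intro!: sum.cong)
    finally show ?thesis ..
  qed
  have "(\<Sum>u\<in>p ` I. \<Sum>v\<in>p ` I. e u * e v * C u v) = (\<Sum>u\<in>p ` I. e u * (\<Sum>v\<in>p ` I. e v * C u v))"
    by (simp add: sum_distrib_left mult.assoc)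
  also have "\<dots> = (\<Sum>i\<in>I. \<Sum>j\<in>I. c i * c j * C (p i) (p j))"
    unfolding group by (simp add: sum_distrib_left mult.assoc)
  finally have var: "(\<Sum>u\<in>p ` I. \<Sum>v\<in>p ` I. e u * e v * C u v) = (\<Sum>i\<in>I. \<Sum>j\<in>I. c i * c j * C (p i) (p j))" .
  have "finite (p ` I)" using assms(2) by simp
  then have "gaussian_rv M (\<lambda>\<omega>. \<Sum>u\<in>p ` I. e u * Y u \<omega>) (\<Sum>u\<in>p ` I. e u * m u) (\<Sum>u\<in>p ` I. \<Sum>v\<in>p ` I. e u * e v * C u v)"
    using assms(1) by (auto simp: gaussian_field_def)
  then show ?thesis
    unfolding group var using assms(1) by (intro gaussian_rv_mgf) (auto simp: gaussian_field_def)
qed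

lemma gaussian_field_measurable:
  assumes "gaussian_field M Y m C"
  shows "Y u \<in> borel_measurable M"
proof -
  have "\<forall>S c. finite S \<longrightarrow> (\<lambda>\<omega>. \<Sum>u\<in>S. c u * Y u \<omega>) \<in> borel_measurable M"
    using assms by (simp add: gaussian_field_def gaussian_rv_def)
  from this[rule_format, of "{u}" "\<lambda>_. 1"] show ?thesis by simp
qed

section \<open>Orthogonal mixing of two independent copies, and the tail of the supremum\<close>

locale centered_gaussian = prob_space M for M :: "'b measure" +
  fixes X :: "'i \<Rightarrow> 'b \<Rightarrow> real" and C :: "'i \<Rightarrow> 'i \<Rightarrow> real"
  assumes X_measurable [measurable]: "\<And>i. X i \<in> borel_measurable M"
    and mgf: "\<And>S c. finite S \<Longrightarrow> (\<integral>\<^sup>+\<omega>. ennreal (exp (\<Sum>i\<in>S. c i * X i \<omega>)) \<partial>M)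
      = ennreal (exp ((\<Sum>i\<in>S. \<Sum>j\<in>S. c i * c j * C i j) / 2))"
begin

text \<open>Two independent copies on the product space: the flag \<open>True\<close> reads the
  first component, \<open>False\<close> the second.\<close>

definition copies :: "'b \<times> 'b \<Rightarrow> 'i \<times> bool \<Rightarrow> real" where
  "copies \<omega> = (\<lambda>(i, b). X i (if b then fst \<omega> else snd \<omega>))"

text \<open>An orthogonal transform of the two copies: the flag \<open>True\<close> marks the
  difference, \<open>False\<close> the sum, each divided by \<open>sqrt 2\<close>.\<close>

definition rotated_copies :: "'b \<times> 'b \<Rightarrow> 'i \<times> bool \<Rightarrow> real" where
  "rotated_copies \<omega> = (\<lambda>(i, b). (X i (snd \<omega>) + (if b then - 1 else 1) * X i (fst \<omega>)) / sqrt 2)"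

lemma copies_measurable [measurable]:
  "copies \<in> M \<Otimes>\<^sub>M M \<rightarrow>\<^sub>M PiM UNIV (\<lambda>_. borel)" "rotated_copies \<in> M \<Otimes>\<^sub>M M \<rightarrow>\<^sub>M PiM UNIV (\<lambda>_. borel)"
  by (rule measurable_PiM_single'; auto simp: copies_def rotated_copies_def split: prod.split)+

text \<open>Orthogonal mixing preserves \<open>a i * a j + b i * b j\<close> for all
  \<open>i\<close> and \<open>j\<close>, hence the moment generating functions of finite linear
  combinations.\<close>

lemma rotation_invariance:
  "distr (M \<Otimes>\<^sub>M M) (PiM UNIV (\<lambda>_. borel)) rotated_copies = distr (M \<Otimes>\<^sub>M M) (PiM UNIV (\<lambda>_. borel)) copies"
proof -
  have two: "(\<integral>\<^sup>+\<omega>. ennreal (exp ((\<Sum>i\<in>T. a i * X i (fst \<omega>)) + (\<Sum>i\<in>T. b i * X i (snd \<omega>)))) \<partial>(M \<Otimes>\<^sub>M M))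
    = ennreal (exp ((\<Sum>i\<in>T. \<Sum>j\<in>T. (a i * a j + b i * b j) * C i j) / 2))" if "finite T" for T a b
  proof -
    have "(\<integral>\<^sup>+\<omega>. ennreal (exp ((\<Sum>i\<in>T. a i * X i (fst \<omega>)) + (\<Sum>i\<in>T. b i * X i (snd \<omega>)))) \<partial>(M \<Otimes>\<^sub>M M))
      = (\<integral>\<^sup>+\<omega>. \<integral>\<^sup>+\<omega>'. ennreal (exp (\<Sum>i\<in>T. a i * X i \<omega>)) * ennreal (exp (\<Sum>i\<in>T. b i * X i \<omega>')) \<partial>M \<partial>M)"
      by (subst nn_integral_fst[symmetric]) (simp_all add: exp_add ennreal_mult)
    also have "\<dots> = ennreal (exp ((\<Sum>i\<in>T. \<Sum>j\<in>T. a i * a j * C i j) / 2)) * ennreal (exp ((\<Sum>i\<in>T. \<Sum>j\<in>T. b i * b j * C i j) / 2))"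
      by (simp add: nn_integral_cmult nn_integral_multc mgf[OF that])
    also have "\<dots> = ennreal (exp ((\<Sum>i\<in>T. \<Sum>j\<in>T. (a i * a j + b i * b j) * C i j) / 2))"
      by (simp add: ennreal_mult[symmetric] exp_add[symmetric] distrib_right sum.distrib add_divide_distrib)
    finally show ?thesis .
  qed
  have split: "\<exists>T a b. finite T \<and> (\<forall>g. (\<Sum>i\<in>S. c i * g i) = (\<Sum>i\<in>T. a i * g (i, True)) + (\<Sum>i\<in>T. b i * g (i, False)))"
    if S: "finite S" for S :: "('i \<times> bool) set" and c :: "'i \<times> bool \<Rightarrow> real"
  proof (intro exI conjI allI)
    show "finite (fst ` S)" using S by simp
    fix g :: "'i \<times> bool \<Rightarrow> real"
    define c' where "c' x = (if x \<in> S then c x else 0)" for x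
    have "(\<Sum>x\<in>S. c x * g x) = (\<Sum>x\<in>fst ` S \<times> UNIV. c' x * g x)"
      using S by (intro sum.mono_neutral_cong_left) (force simp: c'_def)+
    also have "\<dots> = (\<Sum>i\<in>fst ` S. \<Sum>b\<in>UNIV. c' (i, b) * g (i, b))"
      by (subst sum.cartesian_product) (auto intro!: sum.cong)
    also have "\<dots> = (\<Sum>i\<in>fst ` S. c' (i, True) * g (i, True) + c' (i, False) * g (i, False))"
      by (simp add: UNIV_bool add.commute)
    finally show "(\<Sum>x\<in>S. c x * g x) = (\<Sum>i\<in>fst ` S. c' (i, True) * g (i, True)) + (\<Sum>i\<in>fst ` S. c' (i, False) * g (i, False))"
      by (simp add: sum.distrib)
  qed
  have key: "(\<integral>\<^sup>+\<omega>. ennreal (exp (\<Sum>x\<in>S. c x * rotated_copies \<omega> x)) \<partial>(M \<Otimes>\<^sub>M M)) =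
       (\<integral>\<^sup>+\<omega>. ennreal (exp (\<Sum>x\<in>S. c x * copies \<omega> x)) \<partial>(M \<Otimes>\<^sub>M M))
     \<and> (\<integral>\<^sup>+\<omega>. ennreal (exp (\<Sum>x\<in>S. c x * rotated_copies \<omega> x)) \<partial>(M \<Otimes>\<^sub>M M)) < \<infinity>"
    if S: "finite S" for S c
  proof -
    obtain T a b where T: "finite T" and eq: "\<And>g. (\<Sum>x\<in>S. c x * g x) = (\<Sum>i\<in>T. a i * g (i, True)) + (\<Sum>i\<in>T. b i * g (i, False))"
      using split[OF S, of c] by blast
    have 1: "(\<Sum>x\<in>S. c x * copies \<omega> x) = (\<Sum>i\<in>T. a i * X i (fst \<omega>)) + (\<Sum>i\<in>T. b i * X i (snd \<omega>))" for \<omega>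
      by (simp add: eq copies_def)
    have 2: "(\<Sum>x\<in>S. c x * rotated_copies \<omega> x)
       = (\<Sum>i\<in>T. (b i - a i) / sqrt 2 * X i (fst \<omega>)) + (\<Sum>i\<in>T. (a i + b i) / sqrt 2 * X i (snd \<omega>))" for \<omega>
      unfolding eq by (simp add: rotated_copies_def sum.distrib[symmetric]) (auto intro!: sum.cong simp: field_simps)
    have 3: "(b i - a i) / sqrt 2 * ((b j - a j) / sqrt 2) + (a i + b i) / sqrt 2 * ((a j + b j) / sqrt 2) = a i * a j + b i * b j" for i j
      by (simp add: divide_simps) (simp add: algebra_simps)
    show ?thesis
      unfolding 1 2 by (simp only: two[OF T] 3) simp
  qed
  have "distr (M \<Otimes>\<^sub>M M) (PiM UNIV (\<lambda>_. borel)) (\<lambda>\<omega> x. rotated_copies \<omega> x) = distr (M \<Otimes>\<^sub>M M) (PiM UNIV (\<lambda>_. borel)) (\<lambda>\<omega> x. copies \<omega> x)"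
  proof (rule distr_PiM_eqI_mgf)
    show "(\<lambda>\<omega>. rotated_copies \<omega> x) \<in> borel_measurable (M \<Otimes>\<^sub>M M)" "(\<lambda>\<omega>. copies \<omega> x) \<in> borel_measurable (M \<Otimes>\<^sub>M M)" for x
      by measurable
  qed (rule key[THEN conjunct2] key[THEN conjunct1]; assumption)+
  then show ?thesis by simp
qed

text \<open>Let one mixed copy be bounded by \<open>s\<close> and the other exceed \<open>t\<close>
  at some index. Undoing the mixing, both original copies exceed \<open>(t - s) / sqrt 2\<close> at
  that index; invariance and independence give the two products.\<close>

lemma fernique_step:
  assumes D [simp]: "countable D"
  shows "prob {\<omega>\<in>space M. \<forall>i\<in>D. \<bar>X i \<omega>\<bar> \<le> s} * prob {\<omega>\<in>space M. \<exists>i\<in>D. t < \<bar>X i \<omega>\<bar>}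
    \<le> (prob {\<omega>\<in>space M. \<exists>i\<in>D. (t - s) / sqrt 2 < \<bar>X i \<omega>\<bar>})\<^sup>2"
proof -
  let ?A = "{\<omega>\<in>space M. \<forall>i\<in>D. \<bar>X i \<omega>\<bar> \<le> s}" and ?B = "{\<omega>\<in>space M. \<exists>i\<in>D. t < \<bar>X i \<omega>\<bar>}"
    and ?B' = "{\<omega>\<in>space M. \<exists>i\<in>D. (t - s) / sqrt 2 < \<bar>X i \<omega>\<bar>}"
  have [measurable]: "?A \<in> sets M" "?B \<in> sets M" "?B' \<in> sets M" by measurable
  define Q where "Q = {z \<in> space (PiM UNIV (\<lambda>_. borel)). (\<forall>i\<in>D. \<bar>z (i, True) :: real\<bar> \<le> s) \<and> (\<exists>i\<in>D. t < \<bar>z (i, False)\<bar>)}"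
  have [measurable]: "Q \<in> sets (PiM UNIV (\<lambda>_. borel))" unfolding Q_def by measurable
  have AB: "copies -` Q \<inter> space (M \<Otimes>\<^sub>M M) = ?A \<times> ?B"
    by (auto simp: Q_def copies_def space_pair_measure space_PiM)
  have sub: "rotated_copies -` Q \<inter> space (M \<Otimes>\<^sub>M M) \<subseteq> ?B' \<times> ?B'"
  proof safe
    fix \<omega> \<omega>' assume Q: "rotated_copies (\<omega>, \<omega>') \<in> Q" and sp: "(\<omega>, \<omega>') \<in> space (M \<Otimes>\<^sub>M M)"
    then obtain i where i: "i \<in> D" "t < \<bar>rotated_copies (\<omega>, \<omega>') (i, False)\<bar>" "\<bar>rotated_copies (\<omega>, \<omega>') (i, True)\<bar> \<le> s"
      by (auto simp: Q_def)
    define p where "p = rotated_copies (\<omega>, \<omega>') (i, False)"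
    define q where "q = rotated_copies (\<omega>, \<omega>') (i, True)"
    have X: "X i \<omega> = (p - q) / sqrt 2" "X i \<omega>' = (p + q) / sqrt 2"
      by (simp_all add: p_def q_def rotated_copies_def field_simps)
    have "t - s < \<bar>p - q\<bar>" "t - s < \<bar>p + q\<bar>" using i unfolding p_def[symmetric] q_def[symmetric] by linarith+
    then have "(t - s) / sqrt 2 < \<bar>X i \<omega>\<bar>" "(t - s) / sqrt 2 < \<bar>X i \<omega>'\<bar>"
      by (auto simp: X divide_simps)
    then show "\<exists>i\<in>D. (t - s) / sqrt 2 < \<bar>X i \<omega>\<bar>" "\<exists>i\<in>D. (t - s) / sqrt 2 < \<bar>X i \<omega>'\<bar>"
      using i by auto
    show "\<omega> \<in> space M" "\<omega>' \<in> space M" using sp by (auto simp: space_pair_measure)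
  qed
  have "emeasure M ?A * emeasure M ?B = emeasure (M \<Otimes>\<^sub>M M) (?A \<times> ?B)"
    by (subst emeasure_pair_measure_Times) auto
  also have "\<dots> = emeasure (distr (M \<Otimes>\<^sub>M M) (PiM UNIV (\<lambda>_. borel)) copies) Q"
    by (subst emeasure_distr) (auto simp: AB)
  also have "\<dots> = emeasure (M \<Otimes>\<^sub>M M) (rotated_copies -` Q \<inter> space (M \<Otimes>\<^sub>M M))"
    unfolding rotation_invariance[symmetric] by (subst emeasure_distr) auto
  also have "\<dots> \<le> emeasure (M \<Otimes>\<^sub>M M) (?B' \<times> ?B')"
    by (rule emeasure_mono[OF sub]) simp
  also have "\<dots> = emeasure M ?B' * emeasure M ?B'"
    by (subst emeasure_pair_measure_Times) auto
  finally show ?thesis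
    by (simp add: emeasure_eq_measure ennreal_mult[symmetric] power2_eq_square)
qed

text \<open>Each step squares the normalised tail while the level grows only by the factor 8/5,
  which is less than 2, so the exponent outgrows any multiple of the level. The rate 2 is the one
  that \<open>hit_finite\<close> uses.\<close>

lemma fernique_tail:
  assumes D [simp]: "countable D"
    and bounded: "\<And>\<omega>. \<omega> \<in> space M \<Longrightarrow> \<exists>t. \<forall>i\<in>D. \<bar>X i \<omega>\<bar> \<le> t"
  obtains T where "0 \<le> T" "\<And>t. T \<le> t \<Longrightarrow> prob {\<omega>\<in>space M. \<exists>i\<in>D. t < \<bar>X i \<omega>\<bar>} \<le> exp (- 2 * t)"
proof -
  define g where "g t = prob {\<omega>\<in>space M. \<exists>i\<in>D. t < \<bar>X i \<omega>\<bar>}" for t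
  have meas: "{\<omega>\<in>space M. \<exists>i\<in>D. t < \<bar>X i \<omega>\<bar>} \<in> sets M" for t by measurable
  have g_mono: "g t' \<le> g t" if "t \<le> t'" for t t'
    unfolding g_def using that by (intro finite_measure_mono meas) (auto intro: le_less_trans)
  have "(\<lambda>n. g (real n)) \<longlonglongrightarrow> prob (\<Inter>n. {\<omega>\<in>space M. \<exists>i\<in>D. real n < \<bar>X i \<omega>\<bar>})"
    unfolding g_def
  proof (rule finite_Lim_measure_decseq)
    show "range (\<lambda>n. {\<omega>\<in>space M. \<exists>i\<in>D. real n < \<bar>X i \<omega>\<bar>}) \<subseteq> events" using meas by auto
    show "decseq (\<lambda>n. {\<omega>\<in>space M. \<exists>i\<in>D. real n < \<bar>X i \<omega>\<bar>})"
      by (auto simp: decseq_def) (meson le_less_trans of_nat_mono)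
  qed
  also have "(\<Inter>n. {\<omega>\<in>space M. \<exists>i\<in>D. real n < \<bar>X i \<omega>\<bar>}) = {}"
  proof safe
    fix \<omega> assume *: "\<omega> \<in> (\<Inter>n. {\<omega>\<in>space M. \<exists>i\<in>D. real n < \<bar>X i \<omega>\<bar>})"
    then have "\<omega> \<in> space M" by auto
    with bounded obtain t where t: "\<forall>i\<in>D. \<bar>X i \<omega>\<bar> \<le> t" by blast
    obtain n where "t < real n" using reals_Archimedean2 by blast
    moreover from * obtain i where "i \<in> D" "real n < \<bar>X i \<omega>\<bar>" by auto
    ultimately show "\<omega> \<in> {}" using t by force
  qed
  finally have "(\<lambda>n. g (real n)) \<longlonglongrightarrow> 0" by simp
  \<comment> \<open>The value 1/10 yields \<open>p > 9/10\<close>, so the recursion starts at no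
    more than 1/9, which is below \<open>exp (- 1)\<close>.\<close>
  from order_tendstoD(2)[OF this, of "1/10"] have "\<forall>\<^sub>F n in sequentially. g (real n) < 1/10" by simp
  then obtain n1 where n1: "\<And>n. n1 \<le> n \<Longrightarrow> g (real n) < 1/10" by (auto simp: eventually_sequentially)
  define s where "s = real (Suc n1)"
  have s: "0 < s" "g s < 1/10" using n1[of "Suc n1"] by (auto simp: s_def)
  define p where "p = prob {\<omega>\<in>space M. \<forall>i\<in>D. \<bar>X i \<omega>\<bar> \<le> s}"
  have "p = 1 - g s"
    unfolding p_def g_def
    by (subst prob_compl[symmetric, OF meas]) (auto simp: not_less intro!: arg_cong[where f=prob])
  then have p: "9/10 < p" "p \<le> 1" using s measure_nonneg[of M] by (auto simp: g_def)
  \<comment> \<open>The constants ensure \<open>sqrt 2 * \<tau> \<le> 8/5 * \<tau> - s\<close>: with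
    \<open>sqrt 2 \<le> 143/100\<close> the margin is \<open>17/100 * \<tau>\<close>, and
    \<open>\<tau> \<ge> 6 * s\<close> makes it at least \<open>s\<close>.\<close>
  have step: "g (8/5 * \<tau>) / p \<le> (g \<tau> / p)\<^sup>2" if \<tau>: "6 * s \<le> \<tau>" for \<tau>
  proof -
    have "sqrt 2 \<le> 143/100" by (rule real_le_lsqrt) (auto simp: power2_eq_square)
    then have "sqrt 2 * \<tau> \<le> 143/100 * \<tau>" using \<tau> s by (intro mult_right_mono) auto
    then have "\<tau> * sqrt 2 \<le> 8/5 * \<tau> - s" using \<tau> s unfolding mult.commute[of \<tau>] by linarith
    then have "\<tau> \<le> (8/5 * \<tau> - s) / sqrt 2" by (simp add: pos_le_divide_eq)
    then have "p * g (8/5 * \<tau>) \<le> (g \<tau>)\<^sup>2"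
      using fernique_step[OF D, of s "8/5 * \<tau>"] g_mono[of \<tau> "(8/5 * \<tau> - s) / sqrt 2"]
      unfolding p_def[symmetric] g_def[symmetric]
      by (smt (verit) power_mono g_def measure_nonneg)
    then show ?thesis using p by (simp add: power2_eq_square field_simps)
  qed
  define \<tau> where "\<tau> n = 6 * s * (8/5) ^ n" for n
  have \<tau>6: "6 * s \<le> \<tau> n" for n using s one_le_power[of "8/5::real" n] by (simp add: \<tau>_def)
  have \<tau>Suc: "\<tau> (Suc n) = 8/5 * \<tau> n" for n by (simp add: \<tau>_def)
  have rec: "g (\<tau> n) / p \<le> exp (- (2 ^ n))" for n
  proof (induction n)
    case 0
    have "g (\<tau> 0) / p \<le> 1/9"
      using g_mono[of s "\<tau> 0"] s p by (simp add: \<tau>_def field_simps)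
    also have "1/9 \<le> exp (- 1 :: real)"
    proof -
      have "exp 1 \<le> (3::real)" by (rule exp_le)
      then have "1 / 9 \<le> 1 / exp (1::real)" by (intro divide_left_mono) auto
      then show ?thesis by (simp add: exp_minus inverse_eq_divide)
    qed
    finally show ?case by simp
  next
    case (Suc n)
    have "g (\<tau> (Suc n)) / p \<le> (g (\<tau> n) / p)\<^sup>2" unfolding \<tau>Suc by (rule step[OF \<tau>6])
    also have "\<dots> \<le> (exp (- (2 ^ n)))\<^sup>2" using Suc p by (intro power_mono) (auto simp: g_def)
    also have "\<dots> = exp (- (2 ^ Suc n))" by (simp add: power2_eq_square exp_add[symmetric])
    finally show ?case .
  qed
  have "\<forall>\<^sub>F n in sequentially. 2 * \<tau> (Suc n) \<le> 2 ^ n"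
    unfolding \<tau>_def using s by real_asymp
  then obtain n0 where n0: "\<And>n. n0 \<le> n \<Longrightarrow> 2 * \<tau> (Suc n) \<le> 2 ^ n" by (auto simp: eventually_sequentially)
  show thesis
  proof (rule that)
    show "0 \<le> \<tau> n0" using s by (simp add: \<tau>_def)
    fix t assume t: "\<tau> n0 \<le> t"
    have "filterlim \<tau> at_top sequentially" unfolding \<tau>_def using s by real_asymp
    then have "\<forall>\<^sub>F n in sequentially. t < \<tau> n" by (simp add: filterlim_at_top_dense)
    then have ex: "\<exists>n. t < \<tau> n" by (auto simp: eventually_sequentially)
    \<comment> \<open>An arbitrary level lies between two consecutive values of
      \<open>\<tau>\<close>. The tail is taken at the lower one and compared with the upper one,
      hence \<open>Suc n\<close> in the choice of \<open>n0\<close>.\<close>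
    define k where "k = (LEAST n. t < \<tau> n)"
    have k: "t < \<tau> k" unfolding k_def by (rule LeastI_ex[OF ex])
    have mono: "\<tau> i \<le> \<tau> j" if "i \<le> j" for i j
      using that s by (auto simp: \<tau>_def intro!: power_increasing)
    have "n0 < k" using k t mono[of k n0] by (cases "n0 < k") auto
    then obtain n where n: "k = Suc n" "n0 \<le> n" by (cases k) auto
    have "\<tau> n \<le> t" using not_less_Least[of n "\<lambda>n. t < \<tau> n"] n(1) by (simp add: k_def[symmetric] not_less)
    then have "g t \<le> g (\<tau> n)" by (rule g_mono)
    also have "\<dots> \<le> g (\<tau> n) / p" using p by (simp add: g_def field_simps mult_left_le_one_le)
    also have "\<dots> \<le> exp (- (2 ^ n))" by (rule rec)
    also have "\<dots> \<le> exp (- 2 * t)" using n0[OF n(2)] k n(1) by simp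
    finally show "prob {\<omega>\<in>space M. \<exists>i\<in>D. t < \<bar>X i \<omega>\<bar>} \<le> exp (- 2 * t)" by (simp add: g_def)
  qed
qed

end

text \<open>Compare with a sum over balls of integer radii: volumes grow polynomially, whereas
  \<open>exp (- c * real n powr \<alpha>)\<close> decays faster than any power, even for small
  \<open>\<alpha>\<close>.\<close>

lemma nn_integral_exp_neg_norm_powr_finite:
  assumes c: "0 < c" and \<alpha>: "0 < \<alpha>"
  shows "(\<integral>\<^sup>+u. ennreal (exp (- c * norm u powr \<alpha>)) \<partial>(lborel :: 'a::euclidean_space measure)) < \<infinity>"
proof -
  define V where "V = unit_ball_vol (DIM('a))"
  have V: "0 \<le> V" by (simp add: V_def unit_ball_vol_nonneg)
  define e where "e n = exp (- c * real n powr \<alpha>)" for n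
  have "(\<integral>\<^sup>+u. ennreal (exp (- c * norm u powr \<alpha>)) \<partial>(lborel :: 'a measure))
     \<le> (\<integral>\<^sup>+u. (\<Sum>n. ennreal (e n) * indicator (ball 0 (real n + 1)) u) \<partial>(lborel :: 'a measure))"
  proof (rule nn_integral_mono)
    fix u :: 'a
    define n where "n = nat \<lfloor>norm u\<rfloor>"
    have n: "real n \<le> norm u" "norm u < real n + 1" unfolding n_def using norm_ge_zero[of u] by linarith+
    have "real n powr \<alpha> \<le> norm u powr \<alpha>" using n \<alpha> by (intro powr_mono2) auto
    then have "ennreal (exp (- c * norm u powr \<alpha>)) \<le> ennreal (e n) * indicator (ball 0 (real n + 1)) u"
      using n c by (simp add: e_def)
    also have "\<dots> \<le> (\<Sum>n. ennreal (e n) * indicator (ball 0 (real n + 1)) u)"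
    proof -
      define f where "f k = ennreal (e k) * indicator (ball 0 (real k + 1)) u" for k
      have "f n \<le> suminf f" using sum_le_suminf[of f "{n}"] by simp
      then show ?thesis by (simp add: f_def[abs_def])
    qed
    finally show "ennreal (exp (- c * norm u powr \<alpha>)) \<le> (\<Sum>n. ennreal (e n) * indicator (ball 0 (real n + 1)) u)" .
  qed
  also have "\<dots> = (\<Sum>n. ennreal (e n) * emeasure lborel (ball (0::'a) (real n + 1)))"
    by (subst nn_integral_suminf)
      (auto simp: nn_integral_cmult_indicator intro!: borel_measurable_times_ennreal borel_measurable_indicator)
  also have "\<dots> = (\<Sum>n. ennreal (e n * (V * (real n + 1) ^ DIM('a))))"
    by (simp add: emeasure_ball V_def ennreal_mult e_def unit_ball_vol_nonneg)
  also have "\<dots> < \<infinity>"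
  proof -
    have "\<forall>\<^sub>F n in sequentially. norm (e n * (V * (real n + 1) ^ DIM('a))) \<le> V * (1 / real n ^ 2)"
    proof -
      have "\<forall>\<^sub>F n in sequentially. exp (- c * real n powr \<alpha>) * (real n + 1) powr real DIM('a) \<le> 1 / real n ^ 2"
        using c \<alpha> DIM_positive[where 'a='a] by real_asymp
      then show ?thesis
      proof eventually_elim
        case (elim n)
        then have "V * (e n * (real n + 1) ^ DIM('a)) \<le> V * (1 / real n ^ 2)"
          using V by (intro mult_left_mono) (auto simp: e_def powr_realpow)
        then show ?case using V by (simp add: e_def abs_mult mult_ac)
      qed
    qed
    moreover have "summable (\<lambda>n. V * (1 / real n ^ 2))"
      by (intro summable_mult inverse_power_summable[of 2, simplified inverse_eq_divide]) simp
    ultimately have "summable (\<lambda>n. e n * (V * (real n + 1) ^ DIM('a)))"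
      by (rule summable_comparison_test_ev)
    then show ?thesis
      using V by (simp add: suminf_ennreal2 e_def)
  qed
  finally show ?thesis .
qed

lemma nn_integral_exp_neg_abs_finite: "(\<integral>\<^sup>+s. ennreal (exp (- \<bar>s\<bar>)) \<partial>lborel) < \<infinity>"
  using nn_integral_exp_neg_norm_powr_finite[of 1 1, where 'a=real] by simp

section \<open>The Brown-Resnick field\<close>

text \<open>The mean is minus half the variance \<open>2 * norm u powr \<alpha>\<close>, so
  \<open>exp (Y u)\<close> has expectation 1 and can serve as a change of density. Continuity of
  every path fixes the version whose suprema and volumes are considered.\<close>

locale brown_resnick =
  fixes M :: "'b measure" and Y :: "'a::euclidean_space \<Rightarrow> 'b \<Rightarrow> real" and \<alpha> :: real
  assumes \<alpha>_pos: "0 < \<alpha>"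
    and gaussian: "gaussian_field M Y (\<lambda>u. - (norm u powr \<alpha>))
      (\<lambda>u v. norm u powr \<alpha> + norm v powr \<alpha> - norm (u - v) powr \<alpha>)"
    and continuous: "\<And>\<omega>. \<omega> \<in> space M \<Longrightarrow> continuous_on UNIV (\<lambda>u. Y u \<omega>)"
begin

sublocale prob_space M using gaussian by (simp add: gaussian_field_def)

sublocale LM: pair_sigma_finite "lborel :: real measure" M ..

lemma Y_measurable [measurable]: "Y u \<in> borel_measurable M"
  using gaussian by (rule gaussian_field_measurable)

lemma Y_0: "AE \<omega> in M. Y 0 \<omega> = 0"
proof -
  have "\<forall>S c. finite S \<longrightarrow> gaussian_rv M (\<lambda>\<omega>. \<Sum>u\<in>S. c u * Y u \<omega>) (\<Sum>u\<in>S. c u * - (norm u powr \<alpha>))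
     (\<Sum>u\<in>S. \<Sum>v\<in>S. c u * c v * (norm u powr \<alpha> + norm v powr \<alpha> - norm (u - v) powr \<alpha>))"
    using gaussian unfolding gaussian_field_def by (rule conjunct2)
  from this[rule_format, of "{0}" "\<lambda>_. 1"] show ?thesis by (simp add: gaussian_rv_def)
qed

text \<open>A Cameron-Martin shift verified on moment generating functions: the tilted exponent is
  again a linear combination of field values, and the terms involving \<open>v\<close>
  cancel.\<close>

lemma tilted_law:
  "distr (density M (\<lambda>\<omega>. ennreal (exp (Y v \<omega>)))) (PiM UNIV (\<lambda>_. borel)) (\<lambda>\<omega> u. Y (u + v) \<omega> - Y v \<omega>)
    = distr M (PiM UNIV (\<lambda>_. borel)) (\<lambda>\<omega> u. Y u \<omega>)"
proof -
  let ?C = "\<lambda>u v. norm u powr \<alpha> + norm v powr \<alpha> - norm (u - v) powr \<alpha>"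
  have right: "(\<integral>\<^sup>+\<omega>. ennreal (exp (\<Sum>u\<in>S. c u * Y u \<omega>)) \<partial>M)
    = ennreal (exp ((\<Sum>u\<in>S. c u * - (norm u powr \<alpha>)) + (\<Sum>u\<in>S. \<Sum>w\<in>S. c u * c w * ?C u w) / 2))" if "finite S" for S c
    using gaussian_field_mgf[OF gaussian that, of c "\<lambda>u. u"] by simp
  have left: "(\<integral>\<^sup>+\<omega>. ennreal (exp (\<Sum>u\<in>S. c u * (Y (u + v) \<omega> - Y v \<omega>))) \<partial>density M (\<lambda>\<omega>. ennreal (exp (Y v \<omega>))))
    = ennreal (exp ((\<Sum>u\<in>S. c u * - (norm u powr \<alpha>)) + (\<Sum>u\<in>S. \<Sum>w\<in>S. c u * c w * ?C u w) / 2))" if S: "finite S" for S c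
  proof -
    define s where "s = sum c S"
    \<comment> \<open>\<open>None\<close> stands for the point \<open>v\<close>, with the
      coefficient \<open>1 - s\<close> left after tilting and recentring, and \<open>Some u\<close>
      for \<open>u + v\<close>.\<close>
    define I where "I = insert None (Some ` S)"
    define p where "p i = (case i of None \<Rightarrow> v | Some u \<Rightarrow> u + v)" for i
    define e where "e i = (case i of None \<Rightarrow> 1 - s | Some u \<Rightarrow> c u)" for i
    have I: "finite I" using S by (simp add: I_def)
    have sumI: "(\<Sum>i\<in>I. f i) = f None + (\<Sum>u\<in>S. f (Some u))" for f :: "'a option \<Rightarrow> real"
      using S unfolding I_def by (subst sum.insert) (auto simp: sum.reindex)
    define A where "A = (\<Sum>u\<in>S. c u * norm (u + v) powr \<alpha>)"
    define B where "B = (\<Sum>u\<in>S. c u * norm u powr \<alpha>)"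
    define D where "D = (\<Sum>u\<in>S. \<Sum>w\<in>S. c u * c w * norm (u - w) powr \<alpha>)"
    define V where "V = norm v powr \<alpha>"
    have double: "(\<Sum>u\<in>S. \<Sum>w\<in>S. c u * c w * (f u + f w - norm (u - w) powr \<alpha>)) = 2 * s * (\<Sum>u\<in>S. c u * f u) - D" for f :: "'a \<Rightarrow> real"
    proof -
      have "(\<Sum>u\<in>S. \<Sum>w\<in>S. c u * c w * (f u + f w - norm (u - w) powr \<alpha>))
        = (\<Sum>u\<in>S. \<Sum>w\<in>S. (c u * f u) * c w) + (\<Sum>u\<in>S. \<Sum>w\<in>S. c u * (c w * f w)) - D"
        by (simp add: D_def sum.distrib[symmetric] sum_subtractf[symmetric] algebra_simps)
      also have "(\<Sum>u\<in>S. \<Sum>w\<in>S. (c u * f u) * c w) = (\<Sum>u\<in>S. c u * f u) * s"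
        by (simp add: s_def sum_product)
      also have "(\<Sum>u\<in>S. \<Sum>w\<in>S. c u * (c w * f w)) = s * (\<Sum>u\<in>S. c u * f u)"
        by (simp add: s_def sum_product)
      finally show ?thesis by (simp add: algebra_simps)
    qed
    have cross: "(\<Sum>u\<in>S. c u * (V + norm (u + v) powr \<alpha> - norm u powr \<alpha>)) = s * V + A - B"
      by (simp add: s_def A_def B_def algebra_simps sum.distrib sum_subtractf sum_distrib_left)
    have mean: "(\<Sum>i\<in>I. e i * - (norm (p i) powr \<alpha>)) = - (1 - s) * V - A"
      unfolding sumI by (simp add: e_def p_def V_def A_def sum_negf algebra_simps)
    have var: "(\<Sum>i\<in>I. \<Sum>j\<in>I. e i * e j * ?C (p i) (p j)) = 2 * (1 - s)\<^sup>2 * V + 2 * (1 - s) * (s * V + A - B) + (2 * s * A - D)"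
    proof -
      have n: "norm (v - (u + v)) = norm u" for u by (simp add: norm_minus_commute)
      have "(\<Sum>i\<in>I. \<Sum>j\<in>I. e i * e j * ?C (p i) (p j))
        = (1 - s) * (1 - s) * (V + V) + (\<Sum>u\<in>S. (1 - s) * c u * (V + norm (u + v) powr \<alpha> - norm u powr \<alpha>))
        + (\<Sum>u\<in>S. c u * (1 - s) * (norm (u + v) powr \<alpha> + V - norm u powr \<alpha>)
           + (\<Sum>w\<in>S. c u * c w * (norm (u + v) powr \<alpha> + norm (w + v) powr \<alpha> - norm (u - w) powr \<alpha>)))"
        unfolding sumI by (simp add: e_def p_def V_def n)
      also have "(\<Sum>u\<in>S. (1 - s) * c u * (V + norm (u + v) powr \<alpha> - norm u powr \<alpha>)) = (1 - s) * (s * V + A - B)"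
        unfolding cross[symmetric] by (simp add: sum_distrib_left mult.assoc)
      also have "(\<Sum>u\<in>S. c u * (1 - s) * (norm (u + v) powr \<alpha> + V - norm u powr \<alpha>)
           + (\<Sum>w\<in>S. c u * c w * (norm (u + v) powr \<alpha> + norm (w + v) powr \<alpha> - norm (u - w) powr \<alpha>)))
         = (1 - s) * (s * V + A - B) + (2 * s * A - D)"
        unfolding sum.distrib double A_def[symmetric]
        unfolding cross[symmetric] by (simp add: sum_distrib_left mult_ac add.commute)
      finally show ?thesis by (simp add: power2_eq_square)
    qed
    have lin: "Y v \<omega> + (\<Sum>u\<in>S. c u * (Y (u + v) \<omega> - Y v \<omega>)) = (\<Sum>i\<in>I. e i * Y (p i) \<omega>)" for \<omega>
      unfolding sumI by (simp add: e_def p_def s_def algebra_simps sum_subtractf sum_distrib_right)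
    have "(\<integral>\<^sup>+\<omega>. ennreal (exp (\<Sum>u\<in>S. c u * (Y (u + v) \<omega> - Y v \<omega>))) \<partial>density M (\<lambda>\<omega>. ennreal (exp (Y v \<omega>))))
      = (\<integral>\<^sup>+\<omega>. ennreal (exp (\<Sum>i\<in>I. e i * Y (p i) \<omega>)) \<partial>M)"
      by (subst nn_integral_density) (simp_all add: ennreal_mult[symmetric] exp_add[symmetric] lin)
    also have "\<dots> = ennreal (exp ((\<Sum>i\<in>I. e i * - (norm (p i) powr \<alpha>)) + (\<Sum>i\<in>I. \<Sum>j\<in>I. e i * e j * ?C (p i) (p j)) / 2))"
      by (rule gaussian_field_mgf[OF gaussian I])
    \<comment> \<open>The terms in \<open>V\<close> and \<open>A\<close> cancel; what remains is the
      exponent of the untilted field.\<close>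
    also have "(\<Sum>i\<in>I. e i * - (norm (p i) powr \<alpha>)) + (\<Sum>i\<in>I. \<Sum>j\<in>I. e i * e j * ?C (p i) (p j)) / 2
      = - B + (2 * s * B - D) / 2"
      unfolding mean var by (simp add: field_simps power2_eq_square)
    also have "\<dots> = (\<Sum>u\<in>S. c u * - (norm u powr \<alpha>)) + (\<Sum>u\<in>S. \<Sum>w\<in>S. c u * c w * ?C u w) / 2"
      unfolding double by (simp add: B_def sum_negf)
    finally show ?thesis .
  qed
  show ?thesis
    by (rule distr_PiM_eqI_mgf) (simp_all add: left right)
qed

lemma tilt:
  assumes [measurable]: "F \<in> borel_measurable (PiM UNIV (\<lambda>_. borel))"
  shows "(\<integral>\<^sup>+\<omega>. ennreal (exp (Y v \<omega>)) * F (\<lambda>u. Y (u + v) \<omega> - Y v \<omega>) \<partial>M) = (\<integral>\<^sup>+\<omega>. F (\<lambda>u. Y u \<omega>) \<partial>M)"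
proof -
  have [measurable]: "(\<lambda>\<omega> u. Y (u + v) \<omega> - Y v \<omega>) \<in> M \<rightarrow>\<^sub>M PiM UNIV (\<lambda>_. borel)" "(\<lambda>\<omega> u. Y u \<omega>) \<in> M \<rightarrow>\<^sub>M PiM UNIV (\<lambda>_. borel)"
    by (auto intro!: measurable_PiM_single')
  have "(\<integral>\<^sup>+f. F f \<partial>distr (density M (\<lambda>\<omega>. ennreal (exp (Y v \<omega>)))) (PiM UNIV (\<lambda>_. borel)) (\<lambda>\<omega> u. Y (u + v) \<omega> - Y v \<omega>))
    = (\<integral>\<^sup>+f. F f \<partial>distr M (PiM UNIV (\<lambda>_. borel)) (\<lambda>\<omega> u. Y u \<omega>))"
    by (simp only: tilted_law)
  then show ?thesis
    by (simp add: nn_integral_distr nn_integral_density)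
qed

section \<open>The field lifted by an exponentially weighted height, and its stationarity\<close>

definition N :: "(real \<times> 'b) measure" where
  "N = density lborel (\<lambda>s. ennreal (exp (- s))) \<Otimes>\<^sub>M M"

definition W :: "'a \<Rightarrow> real \<times> 'b \<Rightarrow> real" where
  "W u x = Y u (snd x) + fst x"

lemma sets_N [measurable_cong]: "sets N = sets (lborel \<Otimes>\<^sub>M M)"
  unfolding N_def by (intro sets_pair_measure_cong) simp_all

lemma space_N: "space N = UNIV \<times> space M"
  by (simp add: N_def space_pair_measure)

lemma nn_integral_N:
  assumes [measurable]: "f \<in> borel_measurable (lborel \<Otimes>\<^sub>M M)"
  shows "integral\<^sup>N N f = (\<integral>\<^sup>+s. \<integral>\<^sup>+\<omega>. ennreal (exp (- s)) * f (s, \<omega>) \<partial>M \<partial>lborel)"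
proof -
  have "f \<in> borel_measurable (density lborel (\<lambda>s. ennreal (exp (- s))) \<Otimes>\<^sub>M M)"
    using assms sets_N unfolding N_def by (metis measurable_cong_sets)
  then have "integral\<^sup>N N f = (\<integral>\<^sup>+s. \<integral>\<^sup>+\<omega>. f (s, \<omega>) \<partial>M \<partial>density lborel (\<lambda>s. ennreal (exp (- s))))"
    unfolding N_def by (rule nn_integral_fst[symmetric])
  also have "\<dots> = (\<integral>\<^sup>+s. ennreal (exp (- s)) * (\<integral>\<^sup>+\<omega>. f (s, \<omega>) \<partial>M) \<partial>lborel)"
    by (subst nn_integral_density) auto
  also have "\<dots> = (\<integral>\<^sup>+s. \<integral>\<^sup>+\<omega>. ennreal (exp (- s)) * f (s, \<omega>) \<partial>M \<partial>lborel)"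
    by (intro nn_integral_cong nn_integral_cmult[symmetric]) simp
  finally show ?thesis .
qed

lemma sigma_finite_exp: "sigma_finite_measure (density lborel (\<lambda>s::real. ennreal (exp (- s))))"
  by (subst sigma_finite_measure.sigma_finite_iff_density_finite[OF sigma_finite_lborel]) auto

text \<open>For fixed \<open>\<omega>\<close>, translating the height by
  \<open>- Y v \<omega>\<close> recentres the shifted path and produces the weight
  \<open>exp (Y v \<omega>)\<close>; for fixed height, \<open>tilt\<close> then restores the
  original path.\<close>

sublocale field: stationary_field N W
proof -
  interpret S: sigma_finite_measure "density lborel (\<lambda>s::real. ennreal (exp (- s)))" by (rule sigma_finite_exp)
  interpret P: pair_sigma_finite "density lborel (\<lambda>s::real. ennreal (exp (- s)))" M ..
  interpret sigma_finite_measure N unfolding N_def by (rule P.sigma_finite_measure_axioms)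
  show "stationary_field N W"
  proof
    show "W u \<in> borel_measurable N" for u
      unfolding W_def by measurable
    show "continuous_on UNIV (\<lambda>u. W u x)" if "x \<in> space N" for x
      unfolding W_def using that continuous[of "snd x"] by (auto simp: space_N intro!: continuous_intros)
    fix v :: 'a and F :: "('a \<Rightarrow> real) \<Rightarrow> ennreal"
    assume [measurable]: "F \<in> borel_measurable (PiM UNIV (\<lambda>_. borel))"
    have [measurable]: "(\<lambda>x u. Y (u + v) (snd x) + fst x) \<in> lborel \<Otimes>\<^sub>M M \<rightarrow>\<^sub>M PiM UNIV (\<lambda>_. borel)"
      "(\<lambda>x u. Y u (snd x) + fst x) \<in> lborel \<Otimes>\<^sub>M M \<rightarrow>\<^sub>M PiM UNIV (\<lambda>_. borel)"
      "(\<lambda>x u. Y (u + v) (snd x) - Y v (snd x) + fst x) \<in> lborel \<Otimes>\<^sub>M M \<rightarrow>\<^sub>M PiM UNIV (\<lambda>_. borel)"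
      by (auto intro!: measurable_PiM_single')
    have [measurable]: "(\<lambda>f u. f u + s) \<in> PiM UNIV (\<lambda>_. borel) \<rightarrow>\<^sub>M PiM UNIV (\<lambda>_::'a. borel :: real measure)" for s
      by (auto intro!: measurable_PiM_single')
    have "(\<integral>\<^sup>+x. F (\<lambda>u. W (u + v) x) \<partial>N) = (\<integral>\<^sup>+s. \<integral>\<^sup>+\<omega>. ennreal (exp (- s)) * F (\<lambda>u. Y (u + v) \<omega> + s) \<partial>M \<partial>lborel)"
      unfolding W_def by (subst nn_integral_N) auto
    also have "\<dots> = (\<integral>\<^sup>+\<omega>. \<integral>\<^sup>+s. ennreal (exp (- s)) * F (\<lambda>u. Y (u + v) \<omega> + s) \<partial>lborel \<partial>M)"
      by (rule LM.Fubini'[symmetric]) (simp add: split_beta)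
    also have "\<dots> = (\<integral>\<^sup>+\<omega>. \<integral>\<^sup>+s. ennreal (exp (- s)) * (ennreal (exp (Y v \<omega>)) * F (\<lambda>u. Y (u + v) \<omega> - Y v \<omega> + s)) \<partial>lborel \<partial>M)"
    proof (rule nn_integral_cong)
      fix \<omega> assume \<omega>: "\<omega> \<in> space M"
      have [measurable]: "(\<lambda>s u. Y (u + v) \<omega> + s) \<in> borel \<rightarrow>\<^sub>M PiM UNIV (\<lambda>_::'a. borel)"
        by (auto intro!: measurable_PiM_single')
      have "(\<integral>\<^sup>+s. ennreal (exp (- s)) * F (\<lambda>u. Y (u + v) \<omega> + s) \<partial>lborel)
         = (\<integral>\<^sup>+s. ennreal (exp (- (- Y v \<omega> + 1 * s))) * F (\<lambda>u. Y (u + v) \<omega> + (- Y v \<omega> + 1 * s)) \<partial>lborel)"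
        by (subst nn_integral_real_affine[where c=1 and t="- Y v \<omega>"]) auto
      also have "\<dots> = (\<integral>\<^sup>+s. ennreal (exp (- s)) * (ennreal (exp (Y v \<omega>)) * F (\<lambda>u. Y (u + v) \<omega> - Y v \<omega> + s)) \<partial>lborel)"
      proof (rule nn_integral_cong)
        fix s
        have "exp (- (- Y v \<omega> + 1 * s)) = exp (- s) * exp (Y v \<omega>)" by (simp add: exp_add[symmetric])
        moreover have "(\<lambda>u. Y (u + v) \<omega> + (- Y v \<omega> + 1 * s)) = (\<lambda>u. Y (u + v) \<omega> - Y v \<omega> + s)" by auto
        ultimately show "ennreal (exp (- (- Y v \<omega> + 1 * s))) * F (\<lambda>u. Y (u + v) \<omega> + (- Y v \<omega> + 1 * s))
          = ennreal (exp (- s)) * (ennreal (exp (Y v \<omega>)) * F (\<lambda>u. Y (u + v) \<omega> - Y v \<omega> + s))"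
          by (simp only: ennreal_mult' exp_ge_zero mult.assoc)
      qed
      finally show "(\<integral>\<^sup>+s. ennreal (exp (- s)) * F (\<lambda>u. Y (u + v) \<omega> + s) \<partial>lborel)
        = (\<integral>\<^sup>+s. ennreal (exp (- s)) * (ennreal (exp (Y v \<omega>)) * F (\<lambda>u. Y (u + v) \<omega> - Y v \<omega> + s)) \<partial>lborel)" .
    qed
    also have "\<dots> = (\<integral>\<^sup>+s. \<integral>\<^sup>+\<omega>. ennreal (exp (- s)) * (ennreal (exp (Y v \<omega>)) * F (\<lambda>u. Y (u + v) \<omega> - Y v \<omega> + s)) \<partial>M \<partial>lborel)"
      by (rule LM.Fubini') (simp add: split_beta)
    also have "\<dots> = (\<integral>\<^sup>+s. \<integral>\<^sup>+\<omega>. ennreal (exp (- s)) * F (\<lambda>u. Y u \<omega> + s) \<partial>M \<partial>lborel)"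
    proof (rule nn_integral_cong)
      fix s :: real
      have [measurable]: "(\<lambda>\<omega> u. Y (u + v) \<omega> - Y v \<omega> + s) \<in> M \<rightarrow>\<^sub>M PiM UNIV (\<lambda>_. borel)" "(\<lambda>\<omega> u. Y u \<omega> + s) \<in> M \<rightarrow>\<^sub>M PiM UNIV (\<lambda>_. borel)"
        by (auto intro!: measurable_PiM_single')
      show "(\<integral>\<^sup>+\<omega>. ennreal (exp (- s)) * (ennreal (exp (Y v \<omega>)) * F (\<lambda>u. Y (u + v) \<omega> - Y v \<omega> + s)) \<partial>M)
        = (\<integral>\<^sup>+\<omega>. ennreal (exp (- s)) * F (\<lambda>u. Y u \<omega> + s) \<partial>M)"
        using tilt[of "\<lambda>f. F (\<lambda>u. f u + s)" v] by (simp add: nn_integral_cmult)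
    qed
    also have "\<dots> = (\<integral>\<^sup>+x. F (\<lambda>u. W u x) \<partial>N)"
      unfolding W_def by (subst nn_integral_N) auto
    finally show "(\<integral>\<^sup>+x. F (\<lambda>u. W (u + v) x) \<partial>N) = (\<integral>\<^sup>+x. F (\<lambda>u. W u x) \<partial>N)" .
  qed
qed

lemma Y_pair_measurable [measurable]: "(\<lambda>(\<omega>, u). Y u \<omega>) \<in> M \<Otimes>\<^sub>M borel \<rightarrow>\<^sub>M borel"
proof -
  have "(\<lambda>p. ((0::real, fst p), snd p)) \<in> M \<Otimes>\<^sub>M borel \<rightarrow>\<^sub>M N \<Otimes>\<^sub>M borel" by measurable
  from measurable_compose[OF this field.W_pair_measurable] show ?thesis
    by (simp add: W_def split_beta)
qed

text \<open>A factor \<open>t\<close> in the exponent gives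
  \<open>(t * t - t) * norm u powr \<alpha>\<close>, and \<open>t = 1/2\<close> makes this
  smallest.\<close>

lemma nn_integral_half: "(\<integral>\<^sup>+\<omega>. ennreal (exp (Y u \<omega> / 2)) \<partial>M) = ennreal (exp (- (1/4) * norm u powr \<alpha>))"
  using gaussian_field_mgf[OF gaussian, of "{u}" "\<lambda>_. 1/2" "\<lambda>u. u"] by simp

text \<open>At each height, Tonelli and the exponential Markov inequality with exponent 1/2 bound
  the expected volume by a convergent integral over \<open>u\<close>.\<close>

lemma excursion_volume_finite: "AE x in N. field.occ UNIV {0<..} x < \<infinity>"
proof -
  interpret S: sigma_finite_measure "density lborel (\<lambda>s::real. ennreal (exp (- s)))" by (rule sigma_finite_exp)
  interpret P: pair_sigma_finite "density lborel (\<lambda>s::real. ennreal (exp (- s)))" M ..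
  interpret MU: pair_sigma_finite M "lborel :: 'a measure" ..
  have AE: "AE \<omega> in M. field.occ UNIV {0<..} (s, \<omega>) < \<infinity>" for s
  proof -
    have [measurable]: "(\<lambda>\<omega>. field.occ UNIV {0<..} (s, \<omega>)) \<in> borel_measurable M"
      by measurable
    have "(\<integral>\<^sup>+\<omega>. field.occ UNIV {0<..} (s, \<omega>) \<partial>M) = (\<integral>\<^sup>+\<omega>. \<integral>\<^sup>+u. indicator {0<..} (Y u \<omega> + s) \<partial>lborel \<partial>M)"
    proof (rule nn_integral_cong)
      fix \<omega> assume "\<omega> \<in> space M"
      then have "{u\<in>UNIV. W u (s, \<omega>) \<in> {0<..}} \<in> sets borel" by (intro field.occ_sets) (auto simp: space_N)
      then have "field.occ UNIV {0<..} (s, \<omega>) = (\<integral>\<^sup>+u. indicator {u\<in>UNIV. W u (s, \<omega>) \<in> {0<..}} u \<partial>lborel)"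
        by (simp add: field.occ_def)
      also have "\<dots> = (\<integral>\<^sup>+u. indicator {0<..} (Y u \<omega> + s) \<partial>lborel)"
        by (intro nn_integral_cong) (simp add: W_def split: split_indicator)
      finally show "field.occ UNIV {0<..} (s, \<omega>) = (\<integral>\<^sup>+u. indicator {0<..} (Y u \<omega> + s) \<partial>lborel)" .
    qed
    also have "\<dots> = (\<integral>\<^sup>+u. \<integral>\<^sup>+\<omega>. indicator {0<..} (Y u \<omega> + s) \<partial>M \<partial>lborel)"
      by (rule MU.Fubini'[symmetric]) measurable
    also have "\<dots> \<le> (\<integral>\<^sup>+u. ennreal (exp (s / 2)) * ennreal (exp (- (1/4) * norm u powr \<alpha>)) \<partial>(lborel :: 'a measure))"
    proof (rule nn_integral_mono)
      fix u :: 'a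
      have "(\<integral>\<^sup>+\<omega>. indicator {0<..} (Y u \<omega> + s) \<partial>M) \<le> (\<integral>\<^sup>+\<omega>. ennreal (exp (s / 2)) * ennreal (exp (Y u \<omega> / 2)) \<partial>M)"
        by (intro nn_integral_mono) (auto simp: ennreal_mult[symmetric] exp_add[symmetric] add_divide_distrib[symmetric] split: split_indicator)
      also have "\<dots> = ennreal (exp (s / 2)) * ennreal (exp (- (1/4) * norm u powr \<alpha>))"
        by (simp add: nn_integral_cmult nn_integral_half)
      finally show "(\<integral>\<^sup>+\<omega>. indicator {0<..} (Y u \<omega> + s) \<partial>M) \<le> ennreal (exp (s / 2)) * ennreal (exp (- (1/4) * norm u powr \<alpha>))" .
    qed
    also have "\<dots> = ennreal (exp (s / 2)) * (\<integral>\<^sup>+u. ennreal (exp (- (1/4) * norm u powr \<alpha>)) \<partial>(lborel :: 'a measure))"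
      by (rule nn_integral_cmult) measurable
    also have "\<dots> < \<infinity>"
      using nn_integral_exp_neg_norm_powr_finite[of "1/4" \<alpha>, where 'a='a] \<alpha>_pos by (simp add: ennreal_mult_less_top)
    finally have "(\<integral>\<^sup>+\<omega>. field.occ UNIV {0<..} (s, \<omega>) \<partial>M) \<noteq> \<infinity>" by simp
    from nn_integral_PInf_AE[OF _ this] show ?thesis by (simp add: less_top)
  qed
  have "{x \<in> space N. field.occ UNIV {0<..} x < \<infinity>} \<in> sets N" by measurable
  then show ?thesis
    unfolding N_def by (rule P.AE_pair_measure) (intro AE_I2 AE)
qed

lemma hit_eq_nn_integral:
  assumes [measurable]: "Q \<in> sets borel"
  shows "field.hit Q = (\<integral>\<^sup>+s. \<integral>\<^sup>+\<omega>. ennreal (exp (- s)) * indicator {0<..} (field.occ Q {0<..} (s, \<omega>)) \<partial>M \<partial>lborel)"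
proof -
  have "field.hit Q = (\<integral>\<^sup>+x. indicator {x\<in>space N. 0 < field.occ Q {0<..} x} x \<partial>N)"
    unfolding field.hit_def by simp
  also have "\<dots> = (\<integral>\<^sup>+x. indicator {0<..} (field.occ Q {0<..} x) \<partial>N)"
    by (intro nn_integral_cong) (simp split: split_indicator)
  also have "\<dots> = (\<integral>\<^sup>+s. \<integral>\<^sup>+\<omega>. ennreal (exp (- s)) * indicator {0<..} (field.occ Q {0<..} (s, \<omega>)) \<partial>M \<partial>lborel)"
    by (rule nn_integral_N) measurable
  finally show ?thesis .
qed

text \<open>The large weight \<open>exp (- s)\<close> at very negative heights is beaten by the tail
  of the centred field, which is at most \<open>exp (2 * s)\<close> there.\<close>

lemma hit_finite:
  assumes "compact Q"
  shows "field.hit Q < \<infinity>"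
proof -
  have [measurable]: "Q \<in> sets borel" using assms by (simp add: borel_compact)
  define X where "X u \<omega> = Y u \<omega> + norm u powr \<alpha>" for u \<omega>
  interpret X: centered_gaussian M X "\<lambda>u v. norm u powr \<alpha> + norm v powr \<alpha> - norm (u - v) powr \<alpha>"
  proof
    show "X u \<in> borel_measurable M" for u unfolding X_def by measurable
    fix S :: "'a set" and c :: "'a \<Rightarrow> real" assume S: "finite S"
    have "(\<integral>\<^sup>+\<omega>. ennreal (exp (\<Sum>u\<in>S. c u * X u \<omega>)) \<partial>M)
      = (\<integral>\<^sup>+\<omega>. ennreal (exp (\<Sum>u\<in>S. c u * norm u powr \<alpha>)) * ennreal (exp (\<Sum>u\<in>S. c u * Y u \<omega>)) \<partial>M)"
      by (simp add: X_def ennreal_mult[symmetric] exp_add[symmetric] distrib_left sum.distrib add.commute)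
    also have "\<dots> = ennreal (exp (\<Sum>u\<in>S. c u * norm u powr \<alpha>)) * (\<integral>\<^sup>+\<omega>. ennreal (exp (\<Sum>u\<in>S. c u * Y u \<omega>)) \<partial>M)"
      by (rule nn_integral_cmult) measurable
    also have "\<dots> = ennreal (exp ((\<Sum>i\<in>S. \<Sum>j\<in>S. c i * c j * (norm i powr \<alpha> + norm j powr \<alpha> - norm (i - j) powr \<alpha>)) / 2))"
      unfolding gaussian_field_mgf[OF gaussian S, of c "\<lambda>u. u"]
      by (simp add: ennreal_mult[symmetric] exp_add[symmetric] sum_negf)
    finally show "(\<integral>\<^sup>+\<omega>. ennreal (exp (\<Sum>u\<in>S. c u * X u \<omega>)) \<partial>M)
      = ennreal (exp ((\<Sum>i\<in>S. \<Sum>j\<in>S. c i * c j * (norm i powr \<alpha> + norm j powr \<alpha> - norm (i - j) powr \<alpha>)) / 2))" .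
  qed
  \<comment> \<open>The tail bound concerns countable index sets; by continuity a dense subset of
    \<open>Q\<close> detects every exceedance.\<close>
  obtain D where D: "countable D" "D \<subseteq> Q" "Q \<subseteq> closure D" by (rule separable)
  note [simp] = D(1)
  have bounded: "\<exists>t. \<forall>u\<in>D. \<bar>X u \<omega>\<bar> \<le> t" if \<omega>: "\<omega> \<in> space M" for \<omega>
  proof -
    have "continuous_on Q (\<lambda>u. X u \<omega>)"
      unfolding X_def using continuous_on_subset[OF continuous[OF \<omega>], of Q] \<alpha>_pos
      by (intro continuous_intros continuous_on_powr') auto
    then have "bounded ((\<lambda>u. X u \<omega>) ` Q)" by (intro compact_imp_bounded compact_continuous_image assms)
    then show ?thesis using D(2) by (fastforce simp: bounded_iff)
  qed
  obtain T where T: "0 \<le> T" "\<And>t. T \<le> t \<Longrightarrow> prob {\<omega>\<in>space M. \<exists>u\<in>D. t < \<bar>X u \<omega>\<bar>} \<le> exp (- 2 * t)"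
    by (rule X.fernique_tail[OF D(1) bounded]) auto
  have "field.hit Q \<le> (\<integral>\<^sup>+s. ennreal (exp (2 * T)) * ennreal (exp (- \<bar>s\<bar>)) \<partial>lborel)"
    unfolding hit_eq_nn_integral[OF \<open>Q \<in> sets borel\<close>]
  proof (rule nn_integral_mono)
    fix s :: real
    let ?B = "{\<omega>\<in>space M. \<exists>u\<in>D. - s < \<bar>X u \<omega>\<bar>}"
    have [measurable]: "?B \<in> sets M" by measurable
    have "(\<integral>\<^sup>+\<omega>. ennreal (exp (- s)) * indicator {0<..} (field.occ Q {0<..} (s, \<omega>)) \<partial>M)
      \<le> (\<integral>\<^sup>+\<omega>. ennreal (exp (- s)) * indicator ?B \<omega> \<partial>M)"
    proof (intro nn_integral_mono mult_left_mono)
      fix \<omega> assume \<omega>: "\<omega> \<in> space M"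
      have "\<omega> \<in> ?B" if "0 < field.occ Q {0<..} (s, \<omega>)"
      proof -
        have "{u\<in>Q. W u (s, \<omega>) \<in> {0<..}} \<noteq> {}"
          using that unfolding field.occ_def by (metis emeasure_empty less_irrefl)
        then obtain u where u: "u \<in> Q" "- s < Y u \<omega>" by (auto simp: W_def)
        let ?O = "(\<lambda>u. Y u \<omega>) -` {- s<..}"
        have "open ?O" using continuous[OF \<omega>] by (intro open_vimage) auto
        moreover have "?O \<inter> closure D \<noteq> {}" using D(3) u by auto
        ultimately have "?O \<inter> D \<noteq> {}" using open_Int_closure_eq_empty by metis
        then obtain w where w: "w \<in> D" "- s < Y w \<omega>" by auto
        have "Y w \<omega> \<le> \<bar>X w \<omega>\<bar>" by (simp add: X_def order_trans[OF _ abs_ge_self])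
        with w \<omega> show ?thesis by force
      qed
      then show "indicator {0<..} (field.occ Q {0<..} (s, \<omega>)) \<le> (indicator ?B \<omega> :: ennreal)"
        by (auto split: split_indicator)
    qed simp
    also have "\<dots> = ennreal (exp (- s) * prob ?B)"
      by (simp add: nn_integral_cmult emeasure_eq_measure ennreal_mult)
    also have "\<dots> \<le> ennreal (exp (2 * T) * exp (- \<bar>s\<bar>))"
    proof (rule ennreal_leI)
      show "exp (- s) * prob ?B \<le> exp (2 * T) * exp (- \<bar>s\<bar>)"
      \<comment> \<open>Very negative heights use the tail bound; otherwise the probability is
        bounded by 1 and \<open>exp (2 * T)\<close> absorbs the weight.\<close>
      proof (cases "T \<le> - s")
        case True
        have "exp (- s) * prob ?B \<le> exp (- s) * exp (- 2 * - s)"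
          by (intro mult_left_mono T(2)[OF True]) simp
        also have "\<dots> \<le> exp (2 * T) * exp (- \<bar>s\<bar>)" using True T(1) by (simp add: exp_add[symmetric])
        finally show ?thesis .
      next
        case False
        have "exp (- s) * prob ?B \<le> exp (- s) * 1" by (intro mult_left_mono) auto
        also have "\<dots> \<le> exp (2 * T) * exp (- \<bar>s\<bar>)" using False T(1) by (simp add: exp_add[symmetric])
        finally show ?thesis .
      qed
    qed
    finally show "(\<integral>\<^sup>+\<omega>. ennreal (exp (- s)) * indicator {0<..} (field.occ Q {0<..} (s, \<omega>)) \<partial>M) \<le> ennreal (exp (2 * T)) * ennreal (exp (- \<bar>s\<bar>))"
      by (simp add: ennreal_mult)
  qed
  also have "\<dots> = ennreal (exp (2 * T)) * (\<integral>\<^sup>+s. ennreal (exp (- \<bar>s\<bar>)) \<partial>lborel)"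
    by (rule nn_integral_cmult) measurable
  also have "\<dots> < \<infinity>" using nn_integral_exp_neg_abs_finite by (simp add: ennreal_mult_less_top)
  finally show ?thesis .
qed

text \<open>With \<open>y = - s\<close> the hitting mass integrates \<open>exp y\<close> against the
  probability that the supremum exceeds \<open>y\<close>. For \<open>y < 0\<close> that probability
  is 1, since \<open>Y 0 = 0\<close> almost surely; this gives the bounded term of the
  overview.\<close>

lemma hit_cube_eq:
  assumes m: "0 < m"
  shows "field.hit (cbox 0 (m *\<^sub>R One)) = (\<integral>\<^sup>+y. ennreal (exp y) * indicator {..<0} y \<partial>lborel)
    + (\<integral>\<^sup>+ y\<in>{0..}. ennreal (exp y) * emeasure M {\<omega> \<in> space M. (SUP u\<in>cbox 0 (m *\<^sub>R One). Y u \<omega>) \<ge> y} \<partial>lborel)"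
proof -
  let ?Q = "cbox 0 (m *\<^sub>R One) :: 'a set"
  define S where "S \<omega> = (SUP u\<in>?Q. Y u \<omega>)" for \<omega>
  have Q0: "0 \<in> ?Q" using m by (auto simp: mem_box)
  have bdd: "bdd_above ((\<lambda>u. Y u \<omega>) ` ?Q)" if "\<omega> \<in> space M" for \<omega>
    using continuous_on_subset[OF continuous[OF that], of ?Q]
    by (intro bounded_imp_bdd_above compact_imp_bounded compact_continuous_image) auto
  have iff: "0 < field.occ ?Q {0<..} (- y, \<omega>) \<longleftrightarrow> y < S \<omega>" if \<omega>: "\<omega> \<in> space M" for y \<omega>
  proof
    assume "0 < field.occ ?Q {0<..} (- y, \<omega>)"
    then have "{u\<in>?Q. W u (- y, \<omega>) \<in> {0<..}} \<noteq> {}"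
      unfolding field.occ_def by (metis emeasure_empty less_irrefl)
    then obtain u where u: "u \<in> ?Q" "y < Y u \<omega>" by (auto simp: W_def)
    from u(2) cSUP_upper[OF u(1) bdd[OF \<omega>]] show "y < S \<omega>" unfolding S_def by (rule less_le_trans)
  next
    assume "y < S \<omega>"
    then obtain u where u: "u \<in> ?Q" "y < Y u \<omega>"
      unfolding S_def using less_cSUP_iff[of ?Q "\<lambda>u. Y u \<omega>" y] bdd[OF \<omega>] Q0 by auto
    let ?O = "(\<lambda>u. Y u \<omega>) -` {y<..}"
    have O: "open ?O" using continuous[OF \<omega>] by (intro open_vimage) auto
    \<comment> \<open>The exceedance may occur on the boundary of the cube; being an open condition,
      it also occurs in the interior and so on a set of positive volume.\<close>
    have "box 0 (m *\<^sub>R One :: 'a) \<noteq> {}" using m by (simp add: box_ne_empty)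
    then have "?O \<inter> closure (box 0 (m *\<^sub>R One)) \<noteq> {}" using u by (auto simp: closure_box)
    then have "box 0 (m *\<^sub>R One) \<inter> ?O \<noteq> {}"
      using open_Int_closure_eq_empty[OF O] by (metis Int_commute)
    then have "0 < emeasure lborel (box 0 (m *\<^sub>R One) \<inter> ?O)"
      using O by (intro emeasure_lborel_open_pos open_Int open_box)
    also have "\<dots> \<le> field.occ ?Q {0<..} (- y, \<omega>)"
      unfolding field.occ_def
    proof (rule emeasure_mono)
      show "box 0 (m *\<^sub>R One) \<inter> ?O \<subseteq> {u\<in>?Q. W u (- y, \<omega>) \<in> {0<..}}"
        using box_subset_cbox[of 0 "m *\<^sub>R One :: 'a"] by (auto simp: W_def)
      show "{u\<in>?Q. W u (- y, \<omega>) \<in> {0<..}} \<in> sets lborel"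
        using field.occ_sets[of ?Q "{0<..}" "(- y, \<omega>)"] \<omega> by (simp add: space_N)
    qed
    finally show "0 < field.occ ?Q {0<..} (- y, \<omega>)" .
  qed
  \<comment> \<open>The supremum ranges over an uncountable set; its measurability is inherited from
    \<open>occ\<close> through \<open>iff\<close>.\<close>
  have [measurable]: "S \<in> borel_measurable M"
  proof (subst borel_measurable_iff_greater, intro allI)
    fix y
    have "{\<omega>\<in>space M. 0 < field.occ ?Q {0<..} (- y, \<omega>)} \<in> sets M" by measurable
    also have "{\<omega>\<in>space M. 0 < field.occ ?Q {0<..} (- y, \<omega>)} = {\<omega>\<in>space M. y < S \<omega>}" using iff by auto
    finally show "{\<omega>\<in>space M. y < S \<omega>} \<in> sets M" .
  qed
  have "field.hit ?Q = (\<integral>\<^sup>+s. \<integral>\<^sup>+\<omega>. ennreal (exp (- s)) * indicator {0<..} (field.occ ?Q {0<..} (s, \<omega>)) \<partial>M \<partial>lborel)"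
    by (rule hit_eq_nn_integral) simp
  also have "\<dots> = (\<integral>\<^sup>+y. \<integral>\<^sup>+\<omega>. ennreal (exp y) * indicator {0<..} (field.occ ?Q {0<..} (- y, \<omega>)) \<partial>M \<partial>lborel)"
  proof -
    have [measurable]: "(\<lambda>s. \<integral>\<^sup>+\<omega>. ennreal (exp (- s)) * indicator {0<..} (field.occ ?Q {0<..} (s, \<omega>)) \<partial>M) \<in> borel_measurable borel"
      by measurable
    show ?thesis by (subst nn_integral_real_affine[where c="-1" and t=0]) simp_all
  qed
  also have "\<dots> = (\<integral>\<^sup>+y. \<integral>\<^sup>+\<omega>. ennreal (exp y) * indicator {..<S \<omega>} y \<partial>M \<partial>lborel)"
    by (intro nn_integral_cong) (auto split: split_indicator simp: iff)
  also have "\<dots> = (\<integral>\<^sup>+\<omega>. \<integral>\<^sup>+y. ennreal (exp y) * indicator {..<S \<omega>} y \<partial>lborel \<partial>M)"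
    unfolding indicator_def lessThan_iff atMost_iff by (rule LM.Fubini'[symmetric]) measurable
  \<comment> \<open>For each \<open>\<omega>\<close> the strict and weak inequalities differ at the
    single level \<open>S \<omega>\<close>, which is why the integrals are exchanged and then
    exchanged back.\<close>
  also have "\<dots> = (\<integral>\<^sup>+\<omega>. \<integral>\<^sup>+y. ennreal (exp y) * indicator {..S \<omega>} y \<partial>lborel \<partial>M)"
  proof (rule nn_integral_cong, rule nn_integral_cong_AE)
    fix \<omega>
    show "AE y in lborel. ennreal (exp y) * indicator {..<S \<omega>} y = ennreal (exp y) * indicator {..S \<omega>} y"
      using AE_lborel_singleton[of "S \<omega>"] by eventually_elim (auto split: split_indicator)
  qed
  also have "\<dots> = (\<integral>\<^sup>+y. \<integral>\<^sup>+\<omega>. ennreal (exp y) * indicator {..S \<omega>} y \<partial>M \<partial>lborel)"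
    unfolding indicator_def lessThan_iff atMost_iff by (rule LM.Fubini') measurable
  also have "\<dots> = (\<integral>\<^sup>+y. ennreal (exp y) * emeasure M {\<omega>\<in>space M. y \<le> S \<omega>} \<partial>lborel)"
  proof (rule nn_integral_cong)
    fix y :: real
    have "(\<integral>\<^sup>+\<omega>. ennreal (exp y) * indicator {..S \<omega>} y \<partial>M) = (\<integral>\<^sup>+\<omega>. ennreal (exp y) * indicator {\<omega>\<in>space M. y \<le> S \<omega>} \<omega> \<partial>M)"
      by (intro nn_integral_cong) (auto split: split_indicator)
    then show "(\<integral>\<^sup>+\<omega>. ennreal (exp y) * indicator {..S \<omega>} y \<partial>M) = ennreal (exp y) * emeasure M {\<omega>\<in>space M. y \<le> S \<omega>}"
      by (simp add: nn_integral_cmult)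
  qed
  also have "\<dots> = (\<integral>\<^sup>+y. ennreal (exp y) * indicator {..<0} y + ennreal (exp y) * emeasure M {\<omega>\<in>space M. y \<le> S \<omega>} * indicator {0..} y \<partial>lborel)"
  proof (rule nn_integral_cong)
    fix y :: real
    have "emeasure M {\<omega>\<in>space M. y \<le> S \<omega>} = 1" if "y < 0"
    proof (rule emeasure_eq_1_AE)
      show "AE \<omega> in M. \<omega> \<in> {\<omega>\<in>space M. y \<le> S \<omega>}"
        using Y_0 AE_space
      proof eventually_elim
        case (elim \<omega>)
        then show ?case using cSUP_upper[OF Q0 bdd[OF elim(2)]] that by (simp add: S_def)
      qed
    qed measurable
    then show "ennreal (exp y) * emeasure M {\<omega>\<in>space M. y \<le> S \<omega>} = ennreal (exp y) * indicator {..<0} y + ennreal (exp y) * emeasure M {\<omega>\<in>space M. y \<le> S \<omega>} * indicator {0..} y"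
      by (auto split: split_indicator)
  qed
  also have "\<dots> = (\<integral>\<^sup>+y. ennreal (exp y) * indicator {..<0} y \<partial>lborel) + (\<integral>\<^sup>+y. ennreal (exp y) * emeasure M {\<omega>\<in>space M. y \<le> S \<omega>} * indicator {0..} y \<partial>lborel)"
    by (rule nn_integral_add) measurable
  finally show ?thesis by (simp add: S_def)
qed

text \<open>Almost surely \<open>W 0 (b, \<omega>) = b\<close>, so the indicator restricts the
  height to \<open>{0<..\<xi>}\<close>, and the endpoint 0 is a null set.\<close>

lemma density_at_band:
  assumes \<xi>: "0 < \<xi>"
  defines "\<phi> b \<equiv> \<integral>\<^sup>+ \<omega>. inverse (emeasure (lborel :: 'a measure) {u. - b < Y u \<omega> \<and> Y u \<omega> \<le> \<xi> - b}) \<partial>M"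
  shows "field.density_at UNIV {0<..\<xi>} = (\<integral>\<^sup>+b\<in>{0..\<xi>}. ennreal (exp (- b)) * \<phi> b \<partial>lborel)"
    and "\<phi> \<in> borel_measurable borel"
proof -
  have occ: "field.occ UNIV {0<..\<xi>} (b, \<omega>) = emeasure (lborel :: 'a measure) {u. - b < Y u \<omega> \<and> Y u \<omega> \<le> \<xi> - b}" for b \<omega>
    unfolding field.occ_def W_def by (rule arg_cong[where f="emeasure lborel"]) auto
  have [measurable]: "(\<lambda>x. inverse (field.occ UNIV {0<..\<xi>} x)) \<in> borel_measurable (lborel \<Otimes>\<^sub>M M)" by measurable
  have [measurable]: "(\<lambda>\<omega>. inverse (field.occ UNIV {0<..\<xi>} (b, \<omega>))) \<in> borel_measurable M" for b by measurable
  have \<phi>: "\<phi> b = (\<integral>\<^sup>+\<omega>. inverse (field.occ UNIV {0<..\<xi>} (b, \<omega>)) \<partial>M)" for b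
    by (simp add: \<phi>_def occ)
  show "\<phi> \<in> borel_measurable borel" unfolding \<phi> by measurable
  have "field.density_at UNIV {0<..\<xi>}
     = (\<integral>\<^sup>+b. \<integral>\<^sup>+\<omega>. ennreal (exp (- b)) * (indicator {0<..\<xi>} (W 0 (b, \<omega>)) * inverse (field.occ UNIV {0<..\<xi>} (b, \<omega>))) \<partial>M \<partial>lborel)"
    unfolding field.density_at_def by (rule nn_integral_N) measurable
  also have "\<dots> = (\<integral>\<^sup>+b\<in>{0..\<xi>}. ennreal (exp (- b)) * \<phi> b \<partial>lborel)"
  proof (rule nn_integral_cong_AE)
    show "AE b in lborel. (\<integral>\<^sup>+\<omega>. ennreal (exp (- b)) * (indicator {0<..\<xi>} (W 0 (b, \<omega>)) * inverse (field.occ UNIV {0<..\<xi>} (b, \<omega>))) \<partial>M)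
      = ennreal (exp (- b)) * \<phi> b * indicator {0..\<xi>} b"
      using AE_lborel_singleton[of 0]
    proof eventually_elim
      case (elim b)
      have "(\<integral>\<^sup>+\<omega>. ennreal (exp (- b)) * (indicator {0<..\<xi>} (W 0 (b, \<omega>)) * inverse (field.occ UNIV {0<..\<xi>} (b, \<omega>))) \<partial>M)
        = (\<integral>\<^sup>+\<omega>. (ennreal (exp (- b)) * indicator {0..\<xi>} b) * inverse (field.occ UNIV {0<..\<xi>} (b, \<omega>)) \<partial>M)"
      proof (rule nn_integral_cong_AE)
        show "AE \<omega> in M. ennreal (exp (- b)) * (indicator {0<..\<xi>} (W 0 (b, \<omega>)) * inverse (field.occ UNIV {0<..\<xi>} (b, \<omega>)))
          = (ennreal (exp (- b)) * indicator {0..\<xi>} b) * inverse (field.occ UNIV {0<..\<xi>} (b, \<omega>))"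
          using Y_0 by eventually_elim (use elim in \<open>auto simp: W_def split: split_indicator\<close>)
      qed
      also have "\<dots> = (ennreal (exp (- b)) * indicator {0..\<xi>} b) * \<phi> b"
        unfolding \<phi> by (rule nn_integral_cmult) measurable
      finally show ?case by (simp add: mult_ac)
    qed
  qed
  finally show "field.density_at UNIV {0<..\<xi>} = (\<integral>\<^sup>+b\<in>{0..\<xi>}. ennreal (exp (- b)) * \<phi> b \<partial>lborel)" .
qed

end

text \<open>All quantities live in \<open>ennreal\<close>, where the inverse of an infinite volume
  is 0 and that of a null volume is infinite.\<close>

theorem theorem3:
  fixes M :: "'b measure"
    and Y :: "'a::euclidean_space \<Rightarrow> 'b \<Rightarrow> real"
    and \<alpha> :: real and K :: ennreal
  assumes "0 < \<alpha>" and "\<alpha> \<le> 2"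
    and "gaussian_field M Y (\<lambda>u. - (norm u powr \<alpha>))
           (\<lambda>u v. norm u powr \<alpha> + norm v powr \<alpha> - norm (u - v) powr \<alpha>)"
    and "\<forall>\<omega>\<in>space M. continuous_on UNIV (\<lambda>u. Y u \<omega>)"
    and "((\<lambda>m::real. ennreal (1 / m ^ DIM('a)) *
            (\<integral>\<^sup>+ y\<in>{0..}. ennreal (exp y) *
               emeasure M {\<omega> \<in> space M. (SUP u\<in>cbox 0 (m *\<^sub>R One). Y u \<omega>) \<ge> y} \<partial>lborel))
          \<longlongrightarrow> K) at_top"
  shows "((\<lambda>\<xi>::real. \<integral>\<^sup>+ b\<in>{0..\<xi>}.
            (\<integral>\<^sup>+ \<omega>. inverse (emeasure (lborel :: 'a measure)
                 {u. - b < Y u \<omega> \<and> Y u \<omega> \<le> \<xi> - b}) \<partial>M) \<partial>lborel)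
          \<longlongrightarrow> K) (at_right 0)"
proof -
  interpret brown_resnick M Y \<alpha>
    by standard (use assms(1,3,4) in auto)
  \<comment> \<open>The contribution of negative levels; being finite and independent of
    \<open>m\<close>, it vanishes after division by the volume of the cube.\<close>
  define c where "c = (\<integral>\<^sup>+y. ennreal (exp y) * indicator {..<0::real} y \<partial>lborel)"
  have "c \<le> (\<integral>\<^sup>+s. ennreal (exp (- \<bar>s\<bar>)) \<partial>lborel)"
    unfolding c_def by (intro nn_integral_mono) (auto split: split_indicator)
  also have "\<dots> < \<infinity>" by (rule nn_integral_exp_neg_abs_finite)
  finally have c: "c < \<infinity>" .
  have "((\<lambda>m::real. ennreal (1 / m ^ DIM('a))) \<longlongrightarrow> ennreal 0) at_top"
    using DIM_positive[where 'a='a]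
    by (intro tendsto_ennrealI tendsto_divide_0[OF tendsto_const] filterlim_at_top_imp_at_infinity filterlim_pow_at_top filterlim_ident)
  then have "((\<lambda>m::real. c * ennreal (1 / m ^ DIM('a))) \<longlongrightarrow> c * ennreal 0) at_top"
    using c by (intro ennreal_tendsto_cmult) auto
  from tendsto_add[OF this assms(5)]
  have "((\<lambda>m::real. ennreal (1 / m ^ DIM('a)) * field.hit (cbox 0 (m *\<^sub>R One))) \<longlongrightarrow> c * ennreal 0 + K) at_top"
  proof (rule Lim_transform_eventually)
    show "\<forall>\<^sub>F m in at_top. c * ennreal (1 / m ^ DIM('a)) + ennreal (1 / m ^ DIM('a)) *
        (\<integral>\<^sup>+ y\<in>{0..}. ennreal (exp y) * emeasure M {\<omega> \<in> space M. (SUP u\<in>cbox 0 (m *\<^sub>R One). Y u \<omega>) \<ge> y} \<partial>lborel)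
      = ennreal (1 / m ^ DIM('a)) * field.hit (cbox 0 (m *\<^sub>R One))"
      using eventually_gt_at_top[of 0]
      by eventually_elim (simp add: hit_cube_eq c_def distrib_left mult.commute)
  qed
  then have lim: "((\<lambda>m::real. ennreal (1 / m ^ DIM('a)) * field.hit (cbox 0 (m *\<^sub>R One))) \<longlongrightarrow> K) at_top" by simp
  define \<phi> where "\<phi> \<xi> b = (\<integral>\<^sup>+ \<omega>. inverse (emeasure (lborel :: 'a measure) {u. - b < Y u \<omega> \<and> Y u \<omega> \<le> \<xi> - b}) \<partial>M)" for \<xi> b :: real
  \<comment> \<open>Exact for every positive \<open>\<xi>\<close>: only the weight
    \<open>exp (- b)\<close> separates this from the claim, and on the domain of integration it lies
    between \<open>exp (- \<xi>)\<close> and 1.\<close>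
  have K: "K = (\<integral>\<^sup>+b\<in>{0..\<xi>}. ennreal (exp (- b)) * \<phi> \<xi> b \<partial>lborel)" if "0 < \<xi>" for \<xi>
    using field.density_at_eq_limit[OF excursion_volume_finite hit_finite lim that] density_at_band(1)[OF that]
    by (simp add: \<phi>_def)
  have lower: "K \<le> (\<integral>\<^sup>+b\<in>{0..\<xi>}. \<phi> \<xi> b \<partial>lborel)" if "0 < \<xi>" for \<xi>
  proof -
    have "ennreal (exp (- b)) * \<phi> \<xi> b * indicator {0..\<xi>} b \<le> 1 * \<phi> \<xi> b * indicator {0..\<xi>} b" for b
    proof (cases "0 \<le> b")
      case True
      then have "ennreal (exp (- b)) \<le> 1" by (simp add: ennreal_le_1)
      then show ?thesis by (intro mult_right_mono) auto
    qed simp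
    then show ?thesis unfolding K[OF that] by (intro nn_integral_mono) simp
  qed
  have upper: "(\<integral>\<^sup>+b\<in>{0..\<xi>}. \<phi> \<xi> b \<partial>lborel) \<le> ennreal (exp \<xi>) * K" if \<xi>: "0 < \<xi>" for \<xi>
  proof -
    have [measurable]: "\<phi> \<xi> \<in> borel_measurable borel"
      using density_at_band(2)[OF \<xi>] by (simp add: \<phi>_def[abs_def])
    have "\<phi> \<xi> b * indicator {0..\<xi>} b \<le> ennreal (exp \<xi>) * (ennreal (exp (- b)) * \<phi> \<xi> b * indicator {0..\<xi>} b)" for b
    proof (cases "b \<in> {0..\<xi>}")
      case True
      then have "1 \<le> ennreal (exp \<xi> * exp (- b))" by (simp add: exp_add[symmetric] ennreal_1[symmetric] ennreal_le_iff del: ennreal_1)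
      then have "1 * \<phi> \<xi> b \<le> ennreal (exp \<xi> * exp (- b)) * \<phi> \<xi> b" by (rule mult_right_mono) simp
      then show ?thesis using True by (simp add: ennreal_mult mult.assoc)
    qed simp
    then have "(\<integral>\<^sup>+b\<in>{0..\<xi>}. \<phi> \<xi> b \<partial>lborel) \<le> (\<integral>\<^sup>+b. ennreal (exp \<xi>) * (ennreal (exp (- b)) * \<phi> \<xi> b * indicator {0..\<xi>} b) \<partial>lborel)"
      by (intro nn_integral_mono)
    also have "\<dots> = ennreal (exp \<xi>) * K"
      unfolding K[OF \<xi>] by (rule nn_integral_cmult) measurable
    finally show ?thesis .
  qed
  have "((\<lambda>\<xi>::real. ennreal (exp \<xi>)) \<longlongrightarrow> ennreal (exp 0)) (at_right 0)"
    by (intro tendsto_ennrealI tendsto_exp tendsto_ident_at)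
  from tendsto_mult_ennreal[OF this tendsto_const, of K]
  have exp_lim: "((\<lambda>\<xi>::real. ennreal (exp \<xi>) * K) \<longlongrightarrow> K) (at_right 0)" by simp
  have "((\<lambda>\<xi>. \<integral>\<^sup>+b\<in>{0..\<xi>}. \<phi> \<xi> b \<partial>lborel) \<longlongrightarrow> K) (at_right 0)"
  proof (rule tendsto_sandwich[OF _ _ tendsto_const exp_lim])
    show "\<forall>\<^sub>F \<xi> in at_right 0. K \<le> (\<integral>\<^sup>+b\<in>{0..\<xi>}. \<phi> \<xi> b \<partial>lborel)"
      using eventually_at_right_less[of 0] by eventually_elim (rule lower)
    show "\<forall>\<^sub>F \<xi> in at_right 0. (\<integral>\<^sup>+b\<in>{0..\<xi>}. \<phi> \<xi> b \<partial>lborel) \<le> ennreal (exp \<xi>) * K"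
      using eventually_at_right_less[of 0] by eventually_elim (rule upper)
  qed
  then show ?thesis by (simp add: \<phi>_def)
qed

end
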